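(* Let $d\ge 2$ be an integer, let $\nu_d$ be a probability measure on $\Delta_d^{++}$ with $\nu_d(\Delta_{d,sub}^{++})=1$, let $\tau_d=\mu_d\otimes\nu_d$, and let $\delta>0$. Then $$\tau_d\left(\mathfrak{F}(\delta)\right)=\int_{\Delta_d^{++}}p_d\left(\mathcal{E}_d(\sqrt{\delta}\,\Delta)\right)\,\mathrm{d}\nu_d(\Delta).$$ Furthermore, for $\Delta\in\Delta_d^{++}$, the quantity $p_d(\mathcal{E}_d(\sqrt{\delta}\,\Delta))$ satisfies $$g_d(\Delta,\delta)\;\le\;p_d\left(\mathcal{E}_d(\sqrt{\delta}\,\Delta)\right)\;\le\;f_d(\Delta,\delta),$$ where $$g_d(\Delta,\delta):=\max\left\{\widetilde{\sigma}_{d-1}\left(\mathcal{E}_d(\sqrt{\delta}\,\Delta)\right),\;\int_{\mathbb{S}^{d-1}}p_{d-1}\left(\mathcal{E}_d(\sqrt{\delta}\,\Delta)\cap \mathbf{v}^{\perp}\right)\frac{\mathrm{d}\mathbf{v}}{A_d}\right\}$$ and $$f_d(\Delta,\delta):=\min\left\{1,\;\sum_{\substack{\mathbf{n}\in\mathcal{P}(\mathbb{Z}^d)\\ \|\mathbf{n}\|_2\le\sqrt{\delta}\,\|\Delta\|_\infty}}\widetilde{\sigma}_{d-1}\left(\mathcal{E}_d\left(\frac{\sqrt{\delta}}{\|\mathbf{n}\|_2}\Delta\right)\right)\right\}.$$ The sum in $f_d(\Delta,\delta)$ is equal to zero when $\sqrt{\delta}\,\|\Delta\|_\infty<1$.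
   Context: $\Delta_d^{++}$ is the set of $d\times d$ diagonal matrices with strictly positive entries and determinant $1$; an element $\Delta$ is also viewed as the $d$-tuple $(\alpha_1,\dots,\alpha_d)$ of its diagonal entries, and $\|\Delta\|_\infty=\max_i\alpha_i$. $\Delta_{d,sub}^{++}$ is the subset of those $\Delta$ whose diagonal entries are pairwise distinct. $\mathcal{O}_d=O_d(\mathbb{R})$ is the orthogonal group and $\mu_d$ its Haar probability measure. For $\boldsymbol{\alpha}\in(\mathbb{R}_{>0})^d$, $\mathcal{E}_d(\boldsymbol{\alpha}):=\{\mathbf{x}\in\mathbb{R}^d:\sum_{i=1}^d(x_i/\alpha_i)^2\le1\}$ is the full ellipsoid. $B_2(\mathbf{0},r)$ is the closed Euclidean ball of radius $r$ centred at the origin, and $$\mathfrak{F}(\delta):=\{(P,\Delta)\in\mathcal{O}_d\times\Delta_d^{++}: P\cdot\mathbb{Z}^d\cap\Delta\cdot B_2(\mathbf{0},\sqrt{\delta})\ne\{\mathbf{0}\}\}.$$ $\mathbb{S}^{d-1}$ is the Euclidean unit sphere of $\mathbb{R}^d$, $\mathrm{d}\mathbf{v}$ its (unnormalised) surface area element, $A_d=2\pi^{d/2}/\Gamma(d/2)$ its total area, and $\sigma_{d-1}$ the uniform probability measure on it, $\sigma_{d-1}(\mathcal{A})=\frac1{A_d}\int_{\mathcal{A}}\mathrm{d}\mathbf{v}$. For $\mathcal{A}\subset\mathbb{R}^d$ with $\mathcal{A}\cap\mathbb{S}^{d-1}$ measurable, $\widetilde{\sigma}_{d-1}(\mathcal{A}):=\sigma_{d-1}(\mathcal{A}\cap\mathbb{S}^{d-1})$.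 $\mathbf{v}^\perp$ is the hyperplane through the origin with unit normal $\mathbf{v}$. $\mathcal{P}(\mathbb{Z}^d):=\{\mathbf{a}\in\mathbb{Z}^d:\gcd(\mathbf{a})=1\}$. For a closed convex set $\mathcal{C}\subset\mathbb{R}^k$ centred at the origin (i.e. symmetric about it), $p_k(\mathcal{C}):=\mu_k(\{P\in\mathcal{O}_k:P\cdot\mathbb{Z}^k\cap\mathcal{C}\ne\{\mathbf{0}\}\})$. In particular, for $k=1$, $\mathcal{O}_1=\{\pm1\}$ and, for an interval $\mathcal{J}$ centred at $0$, $p_1(\mathcal{J})=1$ if its length is $\ge2$ and $0$ if its length is $<2$. The quantity $p_{d-1}(\mathcal{E}_d(\sqrt\delta\Delta)\cap\mathbf{v}^\perp)$ is defined by identifying $\mathbf{v}^\perp$ with $\mathbb{R}^{d-1}$ through any linear isometry (the value does not depend on the choice, by invariance of $\mu_{d-1}$). *)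

theory Defs
  imports "HOL-Probability.Probability"
begin

definition orthogonal_group :: "(real^'k^'k) set" where
  "orthogonal_group = {P. orthogonal_matrix P}"

text \<open>The Haar probability measure is characterised, as usual, as the Borel probability
  measure that is invariant under left translations.\<close>

definition haar_prob_O :: "(real^'k^'k) measure \<Rightarrow> bool" where
  "haar_prob_O \<mu> \<longleftrightarrow>
     prob_space \<mu> \<and>
     sets \<mu> = sets (restrict_space borel orthogonal_group) \<and>
     (\<forall>Q\<in>orthogonal_group. \<forall>A\<in>sets \<mu>. emeasure \<mu> ((\<lambda>P. Q ** P) ` A) = emeasure \<mu> A)"

definition of_int_vec :: "int^'k \<Rightarrow> real^'k" where
  "of_int_vec a = (\<chi> i. of_int (a $ i))"

definition int_lattice :: "(real^'k) set" where
  "int_lattice = range of_int_vec"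

definition primitive_vectors :: "(int^'k) set" where
  "primitive_vectors = {a. Gcd (range (\<lambda>i. a $ i)) = 1}"

definition hit_prob :: "(real^'k^'k) measure \<Rightarrow> (real^'k) set \<Rightarrow> real" where
  "hit_prob \<mu> C =
     measure \<mu> {P \<in> orthogonal_group. (\<lambda>z. P *v z) ` int_lattice \<inter> C \<noteq> {0}}"

definition hyperplane :: "real^'n \<Rightarrow> (real^'n) set" where
  "hyperplane v = {x. v \<bullet> x = 0}"

definition hyperplane_isometry :: "real^'n \<Rightarrow> (real^'m \<Rightarrow> real^'n) \<Rightarrow> bool" where
  "hyperplane_isometry v f \<longleftrightarrow>
     linear f \<and> (\<forall>x. norm (f x) = norm x) \<and> range f = hyperplane v"

text \<open>Here \<open>'m\<close> has one element less than \<open>'n\<close>.  Lemma \<open>hit_prob_slice_eq\<close> below shows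
  that the value does not depend on the isometry that is chosen.\<close>

definition hit_prob_slice ::
    "(real^'m^'m) measure \<Rightarrow> (real^'n) set \<Rightarrow> real^'n \<Rightarrow> real" where
  "hit_prob_slice \<mu> C v =
     hit_prob \<mu> ((SOME f :: real^'m \<Rightarrow> real^'n. hyperplane_isometry v f) -` (C \<inter> hyperplane v))"

definition ellipsoid :: "real^'n \<Rightarrow> (real^'n) set" where
  "ellipsoid \<alpha> = {x. (\<Sum>i\<in>UNIV. (x $ i / \<alpha> $ i)\<^sup>2) \<le> 1}"

definition Delta_pp :: "(real^'n^'n) set" where
  "Delta_pp = {D. (\<forall>i j. i \<noteq> j \<longrightarrow> D $ i $ j = 0) \<and> (\<forall>i. D $ i $ i > 0) \<and> det D = 1}"

definition diag_vec :: "real^'n^'n \<Rightarrow> real^'n" where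
  "diag_vec D = (\<chi> i. D $ i $ i)"

definition Delta_pp_sub :: "(real^'n^'n) set" where
  "Delta_pp_sub = {D \<in> Delta_pp. inj (\<lambda>i. diag_vec D $ i)}"

definition max_entry :: "real^'n^'n \<Rightarrow> real" where
  "max_entry D = Max (range (\<lambda>i. diag_vec D $ i))"

definition frakF :: "real \<Rightarrow> ((real^'n^'n) \<times> (real^'n^'n)) set" where
  "frakF \<delta> = {(P, D) \<in> orthogonal_group \<times> Delta_pp.
      (\<lambda>z. P *v z) ` int_lattice \<inter> (\<lambda>x. D *v x) ` cball 0 (sqrt \<delta>) \<noteq> {0}}"

text \<open>The surface area measure of the unit sphere is the one of polar coordinates: the area
  of \<open>A\<close> is \<open>d\<close> times the Lebesgue measure of the cone \<open>{r v | 0 < r \<le> 1, v \<in> A}\<close>.\<close>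

definition sphere_area :: "(real^'n) measure" where
  "sphere_area =
     scale_measure (of_nat CARD('n))
       (distr (restrict_space lborel (cball 0 1 - {0})) (restrict_space borel (sphere 0 1))
         (\<lambda>x. x /\<^sub>R norm x))"

definition total_sphere_area :: "nat \<Rightarrow> real" where
  "total_sphere_area d = 2 * pi powr (real d / 2) / Gamma (real d / 2)"

definition sigma_tilde :: "(real^'n) set \<Rightarrow> real" where
  "sigma_tilde A = measure sphere_area (A \<inter> sphere 0 1) / total_sphere_area CARD('n)"

definition g_bound :: "(real^'m^'m) measure \<Rightarrow> real^'n^'n \<Rightarrow> real \<Rightarrow> real" where
  "g_bound \<mu> D \<delta> =
     max (sigma_tilde (ellipsoid (sqrt \<delta> *\<^sub>R diag_vec D)))
         (\<integral>v. hit_prob_slice \<mu> (ellipsoid (sqrt \<delta> *\<^sub>R diag_vec D)) v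
                 / total_sphere_area CARD('n) \<partial>sphere_area)"

definition f_sum :: "real^'n^'n \<Rightarrow> real \<Rightarrow> real" where
  "f_sum D \<delta> =
     (\<Sum>n \<in> {n :: int^'n. n \<in> primitive_vectors \<and>
                      norm (of_int_vec n) \<le> sqrt \<delta> * max_entry D}.
        sigma_tilde (ellipsoid ((sqrt \<delta> / norm (of_int_vec n)) *\<^sub>R diag_vec D)))"

definition f_bound :: "real^'n^'n \<Rightarrow> real \<Rightarrow> real" where
  "f_bound D \<delta> = min 1 (f_sum D \<delta>)"


lemma emeasure_sphere_area:
  fixes A :: "(real^'n) set"
  assumes "A \<in> sets (restrict_space borel (sphere 0 1))"
  shows "emeasure sphere_area A =
    of_nat CARD('n) * emeasure lborel {x \<in> cball 0 1 - {0}. x /\<^sub>R norm x \<in> A}"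
proof -
  have m: "(\<lambda>x::real^'n. x /\<^sub>R norm x) \<in>
      restrict_space lborel (cball 0 1 - {0}) \<rightarrow>\<^sub>M restrict_space borel (sphere 0 1)"
    by (rule measurable_restrict_space2)
       (auto simp: space_restrict_space intro!: measurable_restrict_space1)
  have s: "cball (0::real^'n) 1 - {0} \<in> sets lborel" by simp
  have e: "(\<lambda>x. x /\<^sub>R norm x) -` A \<inter> space (restrict_space lborel (cball 0 1 - {0}))
      = {x \<in> cball (0::real^'n) 1 - {0}. x /\<^sub>R norm x \<in> A}"
    by (auto simp: space_restrict_space)
  have "emeasure (distr (restrict_space lborel (cball 0 1 - {0}))
        (restrict_space borel (sphere 0 1)) (\<lambda>x::real^'n. x /\<^sub>R norm x)) A
     = emeasure (restrict_space lborel (cball 0 1 - {0}))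
         {x \<in> cball (0::real^'n) 1 - {0}. x /\<^sub>R norm x \<in> A}"
    using emeasure_distr[OF m assms] e by simp
  also have "\<dots> = emeasure lborel {x \<in> cball (0::real^'n) 1 - {0}. x /\<^sub>R norm x \<in> A}"
    by (rule emeasure_restrict_space) (use s in auto)
  finally show ?thesis by (simp add: sphere_area_def)
qed

lemma emeasure_sphere_area_sphere:
  "emeasure (sphere_area :: (real^'n) measure) (sphere 0 1) = total_sphere_area CARD('n)"
proof -
  let ?n = "CARD('n)"
  have "sphere 0 1 \<in> sets (restrict_space borel (sphere (0::real^'n) 1))"
    by (auto simp: sets_restrict_space)
  then have "emeasure (sphere_area :: (real^'n) measure) (sphere 0 1) =
    of_nat ?n * emeasure lborel {x \<in> cball (0::real^'n) 1 - {0}. x /\<^sub>R norm x \<in> sphere 0 1}"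
    by (rule emeasure_sphere_area)
  also have "{x \<in> cball (0::real^'n) 1 - {0}. x /\<^sub>R norm x \<in> sphere 0 1} = cball 0 1 - {0}"
    by auto
  also have "emeasure lborel (cball (0::real^'n) 1 - {0}) = emeasure lborel (cball (0::real^'n) 1)"
    by (rule emeasure_Diff_null_set) auto
  also have "\<dots> = ennreal (unit_ball_vol (real ?n))"
    by (simp add: emeasure_cball)
  also have "of_nat ?n * \<dots> = ennreal (real ?n * unit_ball_vol (real ?n))"
    by (simp add: ennreal_mult' ennreal_of_nat_eq_real_of_nat)
  also have "real ?n * unit_ball_vol (real ?n) = total_sphere_area ?n"
  proof -
    define x where "x = real ?n / 2"
    have x: "x > 0" "real ?n = 2 * x" by (simp_all add: x_def)
    then have "x \<notin> \<int>\<^sub>\<le>\<^sub>0" by (meson nonpos_Ints_nonpos not_le)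
    then have G: "Gamma (x + 1) = x * Gamma x" by (rule Gamma_plus1)
    have "Gamma x > 0" using x(1) by (rule Gamma_real_pos)
    then show ?thesis
      unfolding unit_ball_vol_def total_sphere_area_def x_def[symmetric] G
      using x by (simp add: field_simps)
  qed
  finally show ?thesis .
qed

lemma hit_prob_rotate:
  assumes \<mu>: "haar_prob_O (\<mu> :: (real^'k^'k) measure)" and Q: "Q \<in> orthogonal_group"
    and C: "closed C" "0 \<in> C"
  shows "hit_prob \<mu> ((\<lambda>x. Q *v x) -` C) = hit_prob \<mu> C"
proof -
  define S where "S B = {P \<in> orthogonal_group. (\<lambda>z. P *v z) ` int_lattice \<inter> B \<noteq> {0::real^'k}}"
    for B
  have z: "0 \<in> (int_lattice :: (real^'k) set)"
    by (auto simp: int_lattice_def of_int_vec_def vec_eq_iff intro!: image_eqI[of _ _ 0])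
  have S_eq: "S B = {P \<in> orthogonal_group. \<exists>a. of_int_vec a \<noteq> 0 \<and> P *v of_int_vec a \<in> B}"
    if "0 \<in> B" for B
  proof -
    have "(P *v x = 0) = (x = 0)" if "P \<in> orthogonal_group" for P :: "real^'k^'k" and x
      using that by (metis mem_Collect_eq orthogonal_group_def orthogonal_matrix_def
          matrix_left_invertible_ker matrix_vector_mult_0_right)
    moreover have "0 \<in> (\<lambda>z. P *v z) ` int_lattice \<inter> B" for P :: "real^'k^'k"
      using z \<open>0 \<in> B\<close> by (auto intro!: image_eqI[of _ _ 0])
    ultimately have "((\<lambda>z. P *v z) ` int_lattice \<inter> B \<noteq> {0}) =
        (\<exists>a. of_int_vec a \<noteq> 0 \<and> P *v of_int_vec a \<in> B)"
      if "P \<in> orthogonal_group" for P :: "real^'k^'k"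
      using that unfolding int_lattice_def by blast
    then show ?thesis by (auto simp: S_def)
  qed
  have Qt: "transpose Q \<in> orthogonal_group" "Q ** transpose Q = mat 1" "transpose Q ** Q = mat 1"
    using Q by (auto simp: orthogonal_group_def orthogonal_matrix_def orthogonal_matrix_transpose)
  have eq: "(\<lambda>P. transpose Q ** P) ` S C = S ((\<lambda>x. Q *v x) -` C)"
  proof -
    have mulO: "A ** B \<in> orthogonal_group"
      if "A \<in> orthogonal_group" "B \<in> orthogonal_group" for A B :: "real^'k^'k"
      using that by (auto simp: orthogonal_group_def orthogonal_matrix_mul)
    have 0: "0 \<in> (\<lambda>x. Q *v x) -` C" using C by simp
    show ?thesis
    proof safe
      fix P assume "P \<in> S C"
      then show "transpose Q ** P \<in> S ((\<lambda>x. Q *v x) -` C)"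
        using Qt mulO by (auto simp: S_eq[OF C(2)] S_eq[OF 0] matrix_vector_mul_assoc matrix_mul_assoc)
    next
      fix P assume P: "P \<in> S ((\<lambda>x. Q *v x) -` C)"
      then have "Q ** P \<in> S C"
        using Q mulO by (auto simp: S_eq[OF C(2)] S_eq[OF 0] matrix_vector_mul_assoc)
      moreover have "P = transpose Q ** (Q ** P)"
        using Qt by (simp add: matrix_mul_assoc)
      ultimately show "P \<in> (\<lambda>P. transpose Q ** P) ` S C" by blast
    qed
  qed
  have meas: "S C \<in> sets \<mu>"
  proof -
    define U where "U = (\<Union>a\<in>{a. of_int_vec a \<noteq> 0}. {P::real^'k^'k. P *v of_int_vec a \<in> C})"
    have SU: "S C = orthogonal_group \<inter> U"
      by (auto simp: S_eq[OF C(2)] U_def)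
    have B: "{P::real^'k^'k. P *v x \<in> C} \<in> sets borel" for x
    proof -
      have "continuous_on UNIV (\<lambda>P::real^'k^'k. P *v x)"
        unfolding matrix_vector_mult_def by (intro continuous_intros)
      then have "closed ((\<lambda>P::real^'k^'k. P *v x) -` C)"
        using C(1) continuous_closed_vimage continuous_on_eq_continuous_at by blast
      then show ?thesis by (simp add: vimage_def)
    qed
    have "countable (UNIV :: (int^'k) set)"
    proof -
      obtain xs :: "'k list" where xs: "set xs = UNIV"
        using finite_list[OF finite[of "UNIV :: 'k set"]] by blast
      have "inj (\<lambda>a::int^'k. map (\<lambda>i. a $ i) xs)"
      proof (rule injI)
        fix a b :: "int^'k"
        assume "map (\<lambda>i. a $ i) xs = map (\<lambda>i. b $ i) xs"
        then show "a = b" unfolding map_eq_conv xs vec_eq_iff by simp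
      qed
      then show ?thesis by (rule countableI')
    qed
    then have "countable {a::int^'k. of_int_vec a \<noteq> 0}"
      by (rule countable_subset[rotated]) simp
    then have "U \<in> sets borel"
      unfolding U_def by (rule sets.countable_UN') (use B in blast)
    then have "S C \<in> sets (restrict_space borel orthogonal_group)"
      unfolding SU sets_restrict_space by (rule imageI)
    then show ?thesis
      using \<mu> unfolding haar_prob_O_def by blast
  qed
  have "emeasure \<mu> ((\<lambda>P. transpose Q ** P) ` S C) = emeasure \<mu> (S C)"
    using \<mu> meas Qt unfolding haar_prob_O_def by blast
  then show ?thesis
    unfolding eq by (simp add: S_def hit_prob_def measure_def)
qed

lemma hit_prob_slice_eq:
  fixes f :: "real^'m \<Rightarrow> real^'n"
  assumes \<mu>: "haar_prob_O (\<mu> :: (real^'m^'m) measure)"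
    and f: "hyperplane_isometry v f" and C: "closed C" "0 \<in> C"
  shows "hit_prob_slice \<mu> C v = hit_prob \<mu> (f -` (C \<inter> hyperplane v))"
proof -
  define h where "h = (SOME f :: real^'m \<Rightarrow> real^'n. hyperplane_isometry v f)"
  have h: "hyperplane_isometry v h" unfolding h_def by (rule someI[of "hyperplane_isometry v" f, OF f])
  have inj: "inj f"
    using f linear_injective_0[of f] by (metis hyperplane_isometry_def norm_eq_zero)
  define q where "q x = inv f (h x)" for x
  have fq: "f (q x) = h x" for x
    using f h unfolding q_def hyperplane_isometry_def by (metis f_inv_into_f rangeI)
  have linf: "linear f" and linh: "linear h" using f h by (auto simp: hyperplane_isometry_def)
  have "linear q"
    by (rule linearI; rule injD[OF inj])
       (simp_all add: fq linear_add[OF linf] linear_add[OF linh] linear_scale[OF linf] linear_scale[OF linh])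
  moreover have "norm (q x) = norm x" for x
    using f h fq[of x] unfolding hyperplane_isometry_def by metis
  ultimately have "orthogonal_transformation q" by (simp add: orthogonal_transformation)
  then have Q: "matrix q \<in> orthogonal_group"
    by (simp add: orthogonal_group_def orthogonal_transformation_matrix)
  have "h -` (C \<inter> hyperplane v) = (\<lambda>x. matrix q *v x) -` (f -` (C \<inter> hyperplane v))"
    using \<open>linear q\<close> by (auto simp: matrix_works fq)
  moreover have "closed (f -` (C \<inter> hyperplane v))"
  proof (rule continuous_closed_vimage)
    show "closed (C \<inter> hyperplane v)"
      using C by (auto simp: hyperplane_def closed_hyperplane)
    show "isCont f x" for x by (rule linear_continuous_at) (use linf linear_conv_bounded_linear in blast)
  qed
  moreover have "0 \<in> f -` (C \<inter> hyperplane v)"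
    using C linear_0[OF linf] by (simp add: hyperplane_def)
  ultimately show ?thesis
    unfolding hit_prob_slice_def h_def[symmetric] using hit_prob_rotate[OF \<mu> Q] by metis
qed

end

theory Submission
  imports Defs
begin

text \<open>
  For a Haar matrix \<open>P\<close> and a unit vector \<open>u\<close>, the vector \<open>P u\<close> is uniform on the sphere, because
  the Haar measure is also right invariant.  Hence a primitive \<open>n\<close> is mapped into the ellipsoid
  with probability the normalised area of the ellipsoid scaled by \<open>1 / |n|\<close>.  Ellipsoids
  are star-shaped, so a hit is always witnessed by a primitive vector, and the union bound gives
  the upper bound.  One basis vector alone gives the first lower bound.  For the second, only the
  lattice vectors with \<open>k\<close>-th coordinate zero are used: multiplying \<open>P\<close> on the right by a Haar
  matrix that fixes the \<open>k\<close>-th basis vector turns their images into a Haar random lattice of the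
  hyperplane orthogonal to the uniform vector \<open>P e\<^sub>k\<close>.
\<close>

section \<open>Orthogonal invariance of Lebesgue measure\<close>

text \<open>The reflected form comes first because it is the substitution needed in the convolution
  argument below; a translation is then a composition of two reflections.\<close>

lemma nn_integral_lborel_reflect:
  fixes g :: "'a::euclidean_space \<Rightarrow> ennreal"
  assumes [measurable]: "g \<in> borel_measurable borel"
  shows "(\<integral>\<^sup>+x. g (y - x) \<partial>lborel) = (\<integral>\<^sup>+x. g x \<partial>lborel)"
proof -
  have "lborel = distr lborel borel (\<lambda>x::'a. y - x)"
    using lborel_affine[of "-1" y] by (simp add: density_1)
  then have "(\<integral>\<^sup>+x. g x \<partial>lborel) = (\<integral>\<^sup>+x. g x \<partial>distr lborel borel (\<lambda>x. y - x))"
    by simp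
  also have "\<dots> = (\<integral>\<^sup>+x. g (y - x) \<partial>lborel)"
    by (rule nn_integral_distr) simp_all
  finally show ?thesis by simp
qed

lemma nn_integral_lborel_translate:
  fixes g :: "'a::euclidean_space \<Rightarrow> ennreal"
  assumes [measurable]: "g \<in> borel_measurable borel"
  shows "(\<integral>\<^sup>+x. g (x - y) \<partial>lborel) = (\<integral>\<^sup>+x. g x \<partial>lborel)"
  using nn_integral_lborel_reflect[of "\<lambda>x. g (- x)" y] nn_integral_lborel_reflect[of g 0]
  by simp

text \<open>The image measure of \<^term>\<open>lborel\<close> is translation invariant, hence proportional to
  \<^term>\<open>lborel\<close>; the unit ball shows that the factor is 1.\<close>

lemma distr_lborel_orthogonal:
  fixes f :: "'a::euclidean_space \<Rightarrow> 'a"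
  assumes f: "orthogonal_transformation f"
  shows "distr lborel borel f = lborel"
proof (rule measure_eqI)
  fix B assume "B \<in> sets (distr lborel borel f)"
  then have B[measurable]: "B \<in> sets borel" by simp
  have lin: "linear f" using f by (rule orthogonal_transformation_linear)
  have [measurable]: "f \<in> borel \<rightarrow>\<^sub>M borel"
    by (intro borel_measurable_continuous_onI linear_continuous_on) (use lin linear_conv_bounded_linear in blast)
  define c where "c A = emeasure (distr lborel borel f) A" for A
  have c: "c A = (\<integral>\<^sup>+y. indicator A (f y) \<partial>lborel)" if [measurable]: "A \<in> sets borel" for A
  proof -
    have "c A = (\<integral>\<^sup>+y. indicator A y \<partial>distr lborel borel f)" by (simp add: c_def)
    also have "\<dots> = (\<integral>\<^sup>+y. indicator A (f y) \<partial>lborel)" by (rule nn_integral_distr) simp_all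
    finally show ?thesis .
  qed
  \<comment> \<open>Translation invariance of the image measure: by surjectivity the shift by
    \<open>x\<close> is a shift by some \<open>u\<close> before \<open>f\<close> is applied.\<close>
  have shift: "(\<integral>\<^sup>+y. indicator A (f y - x) \<partial>lborel) = c A" if [measurable]: "A \<in> sets borel" for A x
  proof -
    obtain u where u: "f u = x" using orthogonal_transformation_surj[OF f] by (metis surjD)
    have "(\<integral>\<^sup>+y. indicator A (f y - x) \<partial>lborel) = (\<integral>\<^sup>+y. indicator A (f (y - u)) \<partial>lborel)"
      by (simp add: linear_diff[OF lin] u)
    also have "\<dots> = (\<integral>\<^sup>+y. indicator A (f y) \<partial>lborel)"
      by (rule nn_integral_lborel_translate) measurable
    finally show ?thesis using c by simp
  qed
  \<comment> \<open>The unit ball is its own preimage under \<open>f\<close>, so \<open>c A\<close>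
    is known, and its volume is positive and finite, so it can be cancelled at the end.\<close>
  define A where "A = cball (0::'a) 1"
  have A[measurable]: "A \<in> sets borel" by (simp add: A_def)
  \<comment> \<open>The usual uniqueness proof for invariant measures: the double integral of
    \<open>indicator A x * indicator B (f y - x)\<close> gives
    \<open>emeasure lborel A * c B\<close> when \<open>y\<close> is integrated first. Exchanging the
    order and substituting \<open>z = f y - x\<close> gives
    \<open>c A * emeasure lborel B\<close>.\<close>
  have "emeasure lborel A * c B = (\<integral>\<^sup>+x. indicator A x * c B \<partial>lborel)"
    by (simp add: nn_integral_multc)
  also have "\<dots> = (\<integral>\<^sup>+x. \<integral>\<^sup>+y. indicator A x * indicator B (f y - x) \<partial>lborel \<partial>lborel)"
    by (intro nn_integral_cong) (simp add: nn_integral_cmult shift)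
  also have "\<dots> = (\<integral>\<^sup>+y. \<integral>\<^sup>+x. indicator A x * indicator B (f y - x) \<partial>lborel \<partial>lborel)"
    by (rule lborel_pair.Fubini') measurable
  also have "\<dots> = (\<integral>\<^sup>+y. \<integral>\<^sup>+z. indicator A (f y - z) * indicator B z \<partial>lborel \<partial>lborel)"
  proof (rule nn_integral_cong)
    fix y
    show "(\<integral>\<^sup>+x. indicator A x * indicator B (f y - x) \<partial>lborel) =
      (\<integral>\<^sup>+z. indicator A (f y - z) * indicator B z \<partial>lborel)"
      using nn_integral_lborel_reflect[of "\<lambda>z. indicator A z * indicator B (f y - z)" "f y"]
      by simp
  qed
  also have "\<dots> = (\<integral>\<^sup>+z. \<integral>\<^sup>+y. indicator A (f y - z) * indicator B z \<partial>lborel \<partial>lborel)"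
    by (rule lborel_pair.Fubini') measurable
  also have "\<dots> = (\<integral>\<^sup>+z. c A * indicator B z \<partial>lborel)"
    by (intro nn_integral_cong) (simp add: nn_integral_multc shift)
  also have "\<dots> = c A * emeasure lborel B"
    by (simp add: nn_integral_cmult)
  also have "c A = emeasure lborel A"
    by (simp add: c A_def orthogonal_transformation_norm[OF f] indicator_def flip: nn_integral_indicator)
  finally have "emeasure lborel A * c B = emeasure lborel A * emeasure lborel B" .
  moreover have "unit_ball_vol (real DIM('a)) \<noteq> 0"
    by (metis less_irrefl of_nat_0_le_iff unit_ball_vol_pos)
  then have "emeasure lborel A \<noteq> 0" "emeasure lborel A \<noteq> \<top>"
    by (simp_all add: A_def emeasure_cball)
  ultimately show "emeasure (distr lborel borel f) B = emeasure lborel B"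
    by (simp add: ennreal_mult_cancel_left c_def)
qed simp

section \<open>Bi-invariance of the Haar measure\<close>

lemma borel_measurable_vec_nth [measurable (raw)]:
  fixes f :: "'a \<Rightarrow> 'b::real_normed_vector^'n"
  assumes "f \<in> borel_measurable M"
  shows "(\<lambda>x. f x $ i) \<in> borel_measurable M"
  by (rule borel_measurable_continuous_on[OF _ assms, of "\<lambda>v. v $ i"]) (intro continuous_intros)

lemma borel_measurable_matrix_vector_mult [measurable (raw)]:
  fixes f :: "'a \<Rightarrow> real^'k^'l"
  assumes "f \<in> borel_measurable M" "g \<in> borel_measurable M"
  shows "(\<lambda>x. f x *v g x) \<in> borel_measurable M"
  by (rule borel_measurable_continuous_Pair[OF assms])
     (auto simp: matrix_vector_mult_def intro!: continuous_intros)

lemma borel_measurable_matrix_mult [measurable (raw)]: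
  fixes f :: "'a \<Rightarrow> real^'k^'l" and g :: "'a \<Rightarrow> real^'j^'k"
  assumes "f \<in> borel_measurable M" "g \<in> borel_measurable M"
  shows "(\<lambda>x. f x ** g x) \<in> borel_measurable M"
  by (rule borel_measurable_continuous_Pair[OF assms])
     (auto simp: matrix_matrix_mult_def intro!: continuous_intros)

lemma borel_measurable_transpose [measurable (raw)]:
  fixes f :: "'a \<Rightarrow> real^'k^'l"
  assumes "f \<in> borel_measurable M"
  shows "(\<lambda>x. transpose (f x)) \<in> borel_measurable M"
proof -
  have "continuous_on UNIV (transpose :: real^'k^'l \<Rightarrow> _)"
    by (auto simp: transpose_def [abs_def] intro!: continuous_intros)
  from borel_measurable_continuous_on[OF this assms] show ?thesis .
qed

section \<open>Elementary facts on orthogonal matrices\<close>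

lemma orthogonal_group_mult:
  "P \<in> orthogonal_group \<Longrightarrow> Q \<in> orthogonal_group \<Longrightarrow> P ** Q \<in> orthogonal_group"
  by (simp add: orthogonal_group_def orthogonal_matrix_mul)

lemma orthogonal_group_transpose:
  "P \<in> orthogonal_group \<Longrightarrow> transpose P \<in> orthogonal_group"
  by (simp add: orthogonal_group_def orthogonal_matrix_transpose)

lemma orthogonal_group_transpose_mult:
  "P \<in> orthogonal_group \<Longrightarrow> transpose P ** P = mat 1"
  "P \<in> orthogonal_group \<Longrightarrow> P ** transpose P = mat 1"
  by (simp_all add: orthogonal_group_def orthogonal_matrix_def)

lemma orthogonal_group_transformation:
  "P \<in> orthogonal_group \<Longrightarrow> orthogonal_transformation ((*v) P)"
  by (simp add: orthogonal_group_def orthogonal_transformation_matrix)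

lemma orthogonal_group_norm:
  "P \<in> orthogonal_group \<Longrightarrow> norm (P *v x) = norm (x :: real^'k)"
  using orthogonal_transformation_norm[OF orthogonal_group_transformation] .

lemma orthogonal_group_eq_0:
  assumes "P \<in> orthogonal_group"
  shows "P *v x = 0 \<longleftrightarrow> x = (0 :: real^'k)"
  using orthogonal_group_norm[OF assms, of x] by (metis norm_eq_zero)

section \<open>Left, inverse and right invariance\<close>

context
  fixes \<mu> :: "(real^'k^'k) measure"
  assumes haar: "haar_prob_O \<mu>"
begin

lemma prob_space_haar: "prob_space \<mu>"
  using haar by (simp add: haar_prob_O_def)

lemma sets_haar [measurable_cong]: "sets \<mu> = sets (restrict_space borel orthogonal_group)"
  using haar by (simp add: haar_prob_O_def)

lemma space_haar: "space \<mu> = orthogonal_group"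
  using sets_eq_imp_space_eq[OF sets_haar] by (simp add: space_restrict_space)

lemma measurable_haar_borel [measurable]: "(\<lambda>P. P) \<in> \<mu> \<rightarrow>\<^sub>M borel"
  unfolding measurable_cong_sets[OF sets_haar refl] by (rule measurable_restrict_space1) simp

lemma measurable_into_haar:
  assumes "f \<in> M \<rightarrow>\<^sub>M borel" "\<And>x. x \<in> space M \<Longrightarrow> f x \<in> orthogonal_group"
  shows "f \<in> M \<rightarrow>\<^sub>M \<mu>"
  unfolding measurable_cong_sets[OF refl sets_haar]
  using assms by (intro measurable_restrict_space2) auto

text \<open>\<open>haar_prob_O\<close> speaks of images, whereas sections and pushforwards need
  preimages. The preimage under left multiplication by \<open>Q\<close> is the image under left
  multiplication by its transpose.\<close>

lemma haar_left_invariant: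
  assumes Q: "Q \<in> orthogonal_group" and A: "A \<in> sets \<mu>"
  shows "emeasure \<mu> {P \<in> space \<mu>. Q ** P \<in> A} = emeasure \<mu> A"
proof -
  have sub: "A \<subseteq> orthogonal_group" using sets.sets_into_space[OF A] space_haar by simp
  have "{P \<in> space \<mu>. Q ** P \<in> A} = (\<lambda>P. transpose Q ** P) ` A"
  proof safe
    fix P assume "Q ** P \<in> A"
    then have "transpose Q ** (Q ** P) \<in> (\<lambda>P. transpose Q ** P) ` A" by blast
    then show "P \<in> (\<lambda>P. transpose Q ** P) ` A"
      using orthogonal_group_transpose_mult[OF Q] by (simp add: matrix_mul_assoc)
  next
    fix P assume "P \<in> A"
    then show "transpose Q ** P \<in> space \<mu>" "Q ** (transpose Q ** P) \<in> A"
      using sub Q orthogonal_group_transpose_mult[OF Q]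
      by (auto simp: space_haar matrix_mul_assoc intro: orthogonal_group_mult orthogonal_group_transpose)
  qed
  then show ?thesis
    using haar A orthogonal_group_transpose[OF Q] by (simp add: haar_prob_O_def)
qed

text \<open>The set \<open>X\<close> of pairs with \<open>transpose R ** P \<in> A\<close> is
  measured in two ways. For fixed \<open>R\<close> its section is a left translate of
  \<open>A\<close>; for fixed \<open>P\<close> it is a left translate of the set \<open>B\<close> of
  transposes, since \<open>transpose R ** P\<close> is the transpose of
  \<open>transpose P ** R\<close>.\<close>

lemma haar_inverse_invariant:
  assumes A: "A \<in> sets \<mu>"
  shows "emeasure \<mu> {P \<in> space \<mu>. transpose P \<in> A} = emeasure \<mu> A"
proof -
  interpret H: prob_space \<mu> by (rule prob_space_haar)
  interpret pair_prob_space \<mu> \<mu> ..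
  have m: "(\<lambda>(P, R). transpose R ** P) \<in> \<mu> \<Otimes>\<^sub>M \<mu> \<rightarrow>\<^sub>M \<mu>"
    by (rule measurable_into_haar)
       (auto simp: space_pair_measure space_haar intro: orthogonal_group_mult orthogonal_group_transpose)
  have mt: "(\<lambda>R. transpose R) \<in> \<mu> \<rightarrow>\<^sub>M \<mu>"
    by (rule measurable_into_haar) (auto simp: space_haar intro: orthogonal_group_transpose)
  define X where "X = {(P, R) \<in> space (\<mu> \<Otimes>\<^sub>M \<mu>). transpose R ** P \<in> A}"
  have X: "X \<in> sets (\<mu> \<Otimes>\<^sub>M \<mu>)"
    using measurable_sets[OF m A] by (simp add: X_def vimage_def Int_def conj_commute case_prod_beta')
  define B where "B = {R \<in> space \<mu>. transpose R \<in> A}"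
  have B: "B \<in> sets \<mu>"
    using measurable_sets[OF mt A] by (simp add: B_def vimage_def Int_def conj_commute)
  have "emeasure (\<mu> \<Otimes>\<^sub>M \<mu>) X = (\<integral>\<^sup>+P. emeasure \<mu> (Pair P -` X) \<partial>\<mu>)"
    by (rule H.emeasure_pair_measure_alt[OF X])
  also have "\<dots> = (\<integral>\<^sup>+P. emeasure \<mu> B \<partial>\<mu>)"
  proof (rule nn_integral_cong)
    fix P assume P: "P \<in> space \<mu>"
    have "Pair P -` X = {R \<in> space \<mu>. transpose P ** R \<in> B}"
      using P by (auto simp: X_def B_def space_pair_measure matrix_transpose_mul space_haar
          intro: orthogonal_group_mult orthogonal_group_transpose)
    then show "emeasure \<mu> (Pair P -` X) = emeasure \<mu> B"
      using haar_left_invariant[OF orthogonal_group_transpose B] P by (simp add: space_haar)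
  qed
  also have "\<dots> = emeasure \<mu> B" by (simp add: H.emeasure_space_1)
  finally have 1: "emeasure (\<mu> \<Otimes>\<^sub>M \<mu>) X = emeasure \<mu> B" .
  have "emeasure (\<mu> \<Otimes>\<^sub>M \<mu>) X = (\<integral>\<^sup>+R. emeasure \<mu> ((\<lambda>P. (P, R)) -` X) \<partial>\<mu>)"
    by (rule emeasure_pair_measure_alt2[OF X])
  also have "\<dots> = (\<integral>\<^sup>+R. emeasure \<mu> A \<partial>\<mu>)"
  proof (rule nn_integral_cong)
    fix R assume R: "R \<in> space \<mu>"
    have "(\<lambda>P. (P, R)) -` X = {P \<in> space \<mu>. transpose R ** P \<in> A}"
      using R by (auto simp: X_def space_pair_measure)
    then show "emeasure \<mu> ((\<lambda>P. (P, R)) -` X) = emeasure \<mu> A"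
      using haar_left_invariant[OF orthogonal_group_transpose A] R by (simp add: space_haar)
  qed
  also have "\<dots> = emeasure \<mu> A" by (simp add: H.emeasure_space_1)
  finally show ?thesis using 1 by (simp add: B_def)
qed

text \<open>A right translation is a left translation conjugated by inversion, which is
  transposition on orthogonal matrices.\<close>

lemma haar_right_invariant:
  assumes Q: "Q \<in> orthogonal_group" and A: "A \<in> sets \<mu>"
  shows "emeasure \<mu> {P \<in> space \<mu>. P ** Q \<in> A} = emeasure \<mu> A"
proof -
  have mt: "(\<lambda>R. transpose R) \<in> \<mu> \<rightarrow>\<^sub>M \<mu>"
    by (rule measurable_into_haar) (auto simp: space_haar intro: orthogonal_group_transpose)
  have mQ: "(\<lambda>R. R ** Q) \<in> \<mu> \<rightarrow>\<^sub>M \<mu>"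
    by (rule measurable_into_haar) (use Q in \<open>auto simp: space_haar intro: orthogonal_group_mult\<close>)
  define B where "B = {R \<in> space \<mu>. transpose R \<in> A}"
  have B: "B \<in> sets \<mu>"
    using measurable_sets[OF mt A] by (simp add: B_def vimage_def Int_def conj_commute)
  define C where "C = {P \<in> space \<mu>. P ** Q \<in> A}"
  have C: "C \<in> sets \<mu>"
    using measurable_sets[OF mQ A] by (simp add: C_def vimage_def Int_def conj_commute)
  have "emeasure \<mu> C = emeasure \<mu> {P \<in> space \<mu>. transpose P \<in> C}"
    by (rule haar_inverse_invariant[OF C, symmetric])
  also have "{P \<in> space \<mu>. transpose P \<in> C} = {P \<in> space \<mu>. transpose Q ** P \<in> B}"
    using Q by (auto simp: C_def B_def matrix_transpose_mul space_haar
          intro: orthogonal_group_mult orthogonal_group_transpose)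
  also have "emeasure \<mu> \<dots> = emeasure \<mu> B"
    by (rule haar_left_invariant[OF orthogonal_group_transpose[OF Q] B])
  also have "\<dots> = emeasure \<mu> A"
    unfolding B_def by (rule haar_inverse_invariant[OF A])
  finally show ?thesis by (simp add: C_def)
qed

end

section \<open>Orbits of unit vectors and the surface measure\<close>

lemma sets_sphere_area [measurable_cong]:
  "sets (sphere_area :: (real^'n) measure) = sets (restrict_space borel (sphere 0 1))"
  by (simp add: sphere_area_def)

lemma space_sphere_area: "space (sphere_area :: (real^'n) measure) = sphere 0 1"
  using sets_eq_imp_space_eq[OF sets_sphere_area] by (simp add: space_restrict_space)

lemma total_sphere_area_pos: "d > 0 \<Longrightarrow> total_sphere_area d > 0"
  by (simp add: total_sphere_area_def Gamma_real_pos)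

lemma finite_measure_sphere_area: "finite_measure (sphere_area :: (real^'n) measure)"
  by (rule finite_measureI) (simp add: space_sphere_area emeasure_sphere_area_sphere)

lemma sphere_area_borel: "A \<in> sets (sphere_area :: (real^'n) measure) \<Longrightarrow> A \<in> sets borel"
  by (auto simp: sets_sphere_area sets_restrict_space)

lemma measurable_sphere_borel [measurable]: "(\<lambda>v. v) \<in> (sphere_area :: (real^'n) measure) \<rightarrow>\<^sub>M borel"
  unfolding measurable_cong_sets[OF sets_sphere_area refl] by (rule measurable_restrict_space1) simp

lemma measurable_into_sphere:
  assumes "f \<in> M \<rightarrow>\<^sub>M borel" "\<And>x. x \<in> space M \<Longrightarrow> norm (f x) = 1"
  shows "f \<in> M \<rightarrow>\<^sub>M (sphere_area :: (real^'n) measure)"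
  unfolding measurable_cong_sets[OF refl sets_sphere_area]
  using assms by (intro measurable_restrict_space2) auto

text \<open>The area of a set is a constant times the volume of the cone over it, so rotation
  invariance is inherited from Lebesgue measure.\<close>

lemma distr_sphere_area_orthogonal:
  fixes Q :: "real^'n^'n"
  assumes Q: "Q \<in> orthogonal_group"
  shows "distr sphere_area sphere_area ((*v) Q) = sphere_area"
proof (rule measure_eqI)
  have m: "(*v) Q \<in> sphere_area \<rightarrow>\<^sub>M sphere_area"
    by (rule measurable_into_sphere) (auto simp: space_sphere_area orthogonal_group_norm[OF Q])
  fix A assume "A \<in> sets (distr sphere_area sphere_area ((*v) Q))"
  then have A: "A \<in> sets sphere_area" by simp
  note [measurable] = sphere_area_borel[OF A]
  define B where "B = (*v) Q -` A \<inter> space sphere_area"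
  have B: "B \<in> sets sphere_area" unfolding B_def by (rule measurable_sets[OF m A])
  define cone :: "(real^'n) set \<Rightarrow> (real^'n) set"
    where "cone A = {x \<in> cball 0 1 - {0}. x /\<^sub>R norm x \<in> A}" for A
  have [measurable]: "cone A \<in> sets borel" unfolding cone_def by measurable
  \<comment> \<open>Because \<open>Q\<close> preserves norms, it commutes with the normalisation to
    unit length.\<close>
  have "cone B = (*v) Q -` cone A \<inter> space lborel"
    by (auto simp: cone_def B_def space_sphere_area orthogonal_group_norm[OF Q]
        matrix_vector_mult_scaleR orthogonal_group_eq_0[OF Q])
  then have "emeasure lborel (cone B) = emeasure (distr lborel borel ((*v) Q)) (cone A)"
    by (subst emeasure_distr) simp_all
  also have "\<dots> = emeasure lborel (cone A)"
    by (simp add: distr_lborel_orthogonal[OF orthogonal_group_transformation[OF Q]])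
  finally have "emeasure sphere_area B = emeasure sphere_area A"
    using A B by (simp add: emeasure_sphere_area sets_sphere_area cone_def)
  then show "emeasure (distr sphere_area sphere_area ((*v) Q)) A = emeasure sphere_area A"
    by (simp add: emeasure_distr[OF m A] B_def)
qed simp

context
  fixes \<mu> :: "(real^'k^'k) measure"
  assumes haar: "haar_prob_O \<mu>"
begin

lemma measurable_haar_action:
  assumes "norm u = 1"
  shows "(\<lambda>P. P *v u) \<in> \<mu> \<rightarrow>\<^sub>M sphere_area"
proof -
  note [measurable] = measurable_haar_borel[OF haar]
  show ?thesis
    by (rule measurable_into_sphere) (auto simp: space_haar[OF haar] orthogonal_group_norm assms)
qed

lemma nn_integral_haar_right:
  assumes Q: "Q \<in> orthogonal_group" and g: "g \<in> borel_measurable \<mu>"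
  shows "(\<integral>\<^sup>+P. g (P ** Q) \<partial>\<mu>) = (\<integral>\<^sup>+P. g P \<partial>\<mu>)"
proof -
  note [measurable] = measurable_haar_borel[OF haar]
  have m: "(\<lambda>P. P ** Q) \<in> \<mu> \<rightarrow>\<^sub>M \<mu>"
    by (rule measurable_into_haar[OF haar])
       (use Q in \<open>auto simp: space_haar[OF haar] intro: orthogonal_group_mult\<close>)
  have "distr \<mu> \<mu> (\<lambda>P. P ** Q) = \<mu>"
    by (rule measure_eqI)
       (use haar_right_invariant[OF haar Q] in \<open>auto simp: emeasure_distr[OF m] vimage_def Int_def conj_commute\<close>)
  then show ?thesis using nn_integral_distr[OF m, of g] g by simp
qed

text \<open>The left integral is the same for every unit vector in place of \<open>u\<close>, so
  averaging it over the sphere only produces the total area. After exchanging the integrals, the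
  inner one over the sphere is rotation invariant and no longer depends on \<open>P\<close>. The
  area stands as a factor to avoid a division in \<open>ennreal\<close>.\<close>

lemma nn_integral_haar_orbit:
  assumes u: "norm u = 1" and g: "g \<in> borel_measurable sphere_area"
  shows "(\<integral>\<^sup>+P. g (P *v u) \<partial>\<mu>) * ennreal (total_sphere_area CARD('k)) = (\<integral>\<^sup>+v. g v \<partial>sphere_area)"
proof -
  interpret H: prob_space \<mu> by (rule prob_space_haar[OF haar])
  interpret S: finite_measure "sphere_area :: (real^'k) measure" by (rule finite_measure_sphere_area)
  interpret pair_sigma_finite \<mu> "sphere_area :: (real^'k) measure" ..
  note [measurable] = measurable_haar_borel[OF haar] g
  \<comment> \<open>An orthogonal map carries \<open>u\<close> to \<open>v\<close>, and right
    invariance absorbs its matrix.\<close>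
  have orbit: "(\<integral>\<^sup>+P. g (P *v v) \<partial>\<mu>) = (\<integral>\<^sup>+P. g (P *v u) \<partial>\<mu>)" if "norm v = 1" for v
  proof -
    obtain f where f: "orthogonal_transformation f" "f u = v"
      using orthogonal_transformation_exists_1[OF u \<open>norm v = 1\<close>] .
    then have Q: "matrix f \<in> orthogonal_group" "matrix f *v u = v"
      by (simp_all add: orthogonal_group_def orthogonal_transformation_matrix orthogonal_transformation_linear)
    have "(\<lambda>P. g (P *v u)) \<in> borel_measurable \<mu>"
      using measurable_compose[OF measurable_haar_action[OF u] g] .
    from nn_integral_haar_right[OF Q(1) this] show ?thesis
      using Q(2) by (simp flip: matrix_vector_mul_assoc)
  qed
  have m: "(\<lambda>(P, v). P *v v) \<in> \<mu> \<Otimes>\<^sub>M sphere_area \<rightarrow>\<^sub>M sphere_area"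
    by (rule measurable_into_sphere)
       (auto simp: space_pair_measure space_haar[OF haar] orthogonal_group_norm space_sphere_area)
  have m': "(\<lambda>(P, v). g (P *v v)) \<in> borel_measurable (\<mu> \<Otimes>\<^sub>M sphere_area)"
    using measurable_compose[OF m g] by (simp add: case_prod_beta')
  have "(\<integral>\<^sup>+P. g (P *v u) \<partial>\<mu>) * ennreal (total_sphere_area CARD('k)) =
      (\<integral>\<^sup>+v. (\<integral>\<^sup>+P. g (P *v u) \<partial>\<mu>) \<partial>(sphere_area :: (real^'k) measure))"
    by (simp add: space_sphere_area emeasure_sphere_area_sphere)
  also have "\<dots> = (\<integral>\<^sup>+v. \<integral>\<^sup>+P. g (P *v v) \<partial>\<mu> \<partial>sphere_area)"
    by (rule nn_integral_cong) (simp add: space_sphere_area orbit)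
  also have "\<dots> = (\<integral>\<^sup>+P. \<integral>\<^sup>+v. g (P *v v) \<partial>sphere_area \<partial>\<mu>)"
    using Fubini'[OF m'] by simp
  also have "\<dots> = (\<integral>\<^sup>+P. \<integral>\<^sup>+v. g v \<partial>sphere_area \<partial>\<mu>)"
  proof (rule nn_integral_cong)
    fix P assume "P \<in> space \<mu>"
    then have P: "P \<in> orthogonal_group" by (simp add: space_haar[OF haar])
    have "(*v) P \<in> sphere_area \<rightarrow>\<^sub>M sphere_area"
      by (rule measurable_into_sphere) (auto simp: space_sphere_area orthogonal_group_norm[OF P])
    from nn_integral_distr[OF this, of g] g
    show "(\<integral>\<^sup>+v. g (P *v v) \<partial>sphere_area) = (\<integral>\<^sup>+v. g v \<partial>sphere_area)"
      by (simp add: distr_sphere_area_orthogonal[OF P])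
  qed
  also have "\<dots> = (\<integral>\<^sup>+v. g v \<partial>sphere_area)"
    by (simp add: H.emeasure_space_1)
  finally show ?thesis .
qed

lemma measure_haar_orbit:
  assumes u: "norm u = 1" and A: "A \<in> sets borel"
  shows "measure \<mu> {P \<in> space \<mu>. P *v u \<in> A} = sigma_tilde A"
proof -
  interpret H: prob_space \<mu> by (rule prob_space_haar[OF haar])
  interpret S: finite_measure "sphere_area :: (real^'k) measure" by (rule finite_measure_sphere_area)
  note [measurable] = measurable_haar_borel[OF haar] A
  have A': "A \<inter> sphere 0 1 \<in> sets sphere_area"
    using A by (auto simp: sets_sphere_area sets_restrict_space)
  let ?E = "{P \<in> space \<mu>. P *v u \<in> A}"
  have "emeasure \<mu> ?E = (\<integral>\<^sup>+P. indicator ?E P \<partial>\<mu>)"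
    by simp
  also have "\<dots> = (\<integral>\<^sup>+P. indicator (A \<inter> sphere 0 1) (P *v u) \<partial>\<mu>)"
    by (rule nn_integral_cong)
       (auto simp: indicator_def space_haar[OF haar] orthogonal_group_norm u)
  finally have "emeasure \<mu> ?E * ennreal (total_sphere_area CARD('k)) =
      emeasure sphere_area (A \<inter> sphere 0 1)"
    using nn_integral_haar_orbit[OF u, of "indicator (A \<inter> sphere 0 1)"] A' by simp
  then have "measure \<mu> ?E * total_sphere_area CARD('k) = measure sphere_area (A \<inter> sphere 0 1)"
    using total_sphere_area_pos[of "CARD('k)"]
    by (simp add: H.emeasure_eq_measure S.emeasure_eq_measure flip: ennreal_mult)
  then show ?thesis
    using total_sphere_area_pos[of "CARD('k)"] by (simp add: sigma_tilde_def field_simps)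
qed

end

section \<open>Lattice points in ellipsoids\<close>

lemma countable_int_vectors: "countable (A :: (int^'k) set)"
  by (rule countable_subset[OF subset_UNIV]) simp

lemma of_int_vec_eq_0 [simp]: "of_int_vec a = 0 \<longleftrightarrow> a = 0"
  by (simp add: of_int_vec_def vec_eq_iff)

lemma norm_of_int_vec_ge_1:
  assumes "a \<noteq> 0"
  shows "norm (of_int_vec a) \<ge> 1"
proof -
  obtain i where "a $ i \<noteq> 0" using assms by (auto simp: vec_eq_iff)
  then have "1 \<le> \<bar>of_int_vec a $ i\<bar>"
    by (simp add: of_int_vec_def flip: of_int_abs)
  also have "\<dots> \<le> norm (of_int_vec a)" by (rule component_le_norm_cart)
  finally show ?thesis .
qed

lemma primitive_nonzero: "n \<in> primitive_vectors \<Longrightarrow> n \<noteq> 0"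
  by (auto simp: primitive_vectors_def)

text \<open>Dividing by the gcd \<open>g\<close> of the coordinates works because \<open>g\<close>
  can be pulled out again: \<open>g\<close> equals \<open>g\<close> times the gcd of the quotients,
  so that gcd is 1.\<close>

lemma primitive_decomposition:
  fixes a :: "int^'k"
  assumes "a \<noteq> 0"
  obtains g n where "g \<ge> 1" "n \<in> primitive_vectors" "of_int_vec a = real_of_int g *\<^sub>R of_int_vec n"
proof -
  define g where "g = Gcd (range (\<lambda>i. a $ i))"
  define n where "n = (\<chi> i. a $ i div g)"
  have g0: "g \<noteq> 0" using assms by (auto simp: g_def vec_eq_iff)
  moreover have "g \<ge> 0" unfolding g_def by simp
  ultimately have g: "g \<ge> 1" by linarith
  have a: "a $ i = g * n $ i" for i by (simp add: n_def g_def Gcd_dvd)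
  have "(\<lambda>i. a $ i) = (\<lambda>i. g * n $ i)" by (rule ext) (rule a)
  then have eq: "(*) g ` range (\<lambda>i. n $ i) = range (\<lambda>i. a $ i)" by (simp only: image_image)
  have "g = Gcd ((*) g ` range (\<lambda>i. n $ i))" unfolding eq by (rule g_def)
  also have "\<dots> = g * Gcd (range (\<lambda>i. n $ i))"
    unfolding Gcd_mult normalize_mult using g by simp
  finally have "n \<in> primitive_vectors" using g0 by (simp add: primitive_vectors_def)
  moreover have "of_int_vec a = real_of_int g *\<^sub>R of_int_vec n"
    by (simp add: of_int_vec_def vec_eq_iff a)
  ultimately show ?thesis using that g by blast
qed

text \<open>Makes the index set of the union bound over primitive vectors finite: each coordinate is
  bounded by the norm and lies in a finite interval of integers.\<close>

lemma finite_int_vectors_bounded: "finite {a :: int^'k. norm (of_int_vec a) \<le> R}"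
proof (rule finite_subset)
  show "{a :: int^'k. norm (of_int_vec a) \<le> R} \<subseteq> {a. \<forall>i. a $ i \<in> {-\<lceil>R\<rceil>..\<lceil>R\<rceil>}}"
  proof clarify
    fix a :: "int^'k" and i
    assume "norm (of_int_vec a) \<le> R"
    then have "\<bar>of_int_vec a $ i\<bar> \<le> R"
      using component_le_norm_cart order_trans by blast
    then have "\<bar>real_of_int (a $ i)\<bar> \<le> R" by (simp add: of_int_vec_def)
    then show "a $ i \<in> {-\<lceil>R\<rceil>..\<lceil>R\<rceil>}" by (simp add: abs_le_iff) linarith
  qed
  have "{a. \<forall>i. a $ i \<in> {-\<lceil>R\<rceil>..\<lceil>R\<rceil>}} \<subseteq> vec_lambda ` (\<Pi>\<^sub>E i\<in>(UNIV::'k set). {-\<lceil>R\<rceil>..\<lceil>R\<rceil>})"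
  proof
    fix x assume "x \<in> {a. \<forall>i::'k. a $ i \<in> {-\<lceil>R\<rceil>..\<lceil>R\<rceil>}}"
    then have "vec_nth x \<in> (\<Pi>\<^sub>E i\<in>UNIV. {-\<lceil>R\<rceil>..\<lceil>R\<rceil>})" by (simp add: PiE_UNIV_domain Pi_iff)
    then show "x \<in> vec_lambda ` (\<Pi>\<^sub>E i\<in>(UNIV::'k set). {-\<lceil>R\<rceil>..\<lceil>R\<rceil>})"
      by (rule image_eqI[rotated]) simp
  qed
  then show "finite {a :: int^'k. \<forall>i. a $ i \<in> {-\<lceil>R\<rceil>..\<lceil>R\<rceil>}}"
    by (rule finite_subset) (intro finite_imageI finite_PiE; simp)
qed

section \<open>Geometry of ellipsoids\<close>

lemma closed_ellipsoid: "closed (ellipsoid \<alpha> :: (real^'n) set)"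
  unfolding ellipsoid_def divide_inverse by (intro closed_Collect_le continuous_intros)

lemma zero_in_ellipsoid: "0 \<in> ellipsoid \<alpha>"
  by (simp add: ellipsoid_def)

text \<open>Star-shapedness about the origin, used to replace a lattice vector by the primitive
  vector on its ray.\<close>

lemma scaleR_in_ellipsoid:
  assumes "t *\<^sub>R x \<in> ellipsoid \<alpha>" "t \<ge> 1"
  shows "x \<in> ellipsoid \<alpha>"
proof -
  have "(\<Sum>i\<in>UNIV. (x $ i / \<alpha> $ i)\<^sup>2) \<le> (\<Sum>i\<in>UNIV. ((t *\<^sub>R x) $ i / \<alpha> $ i)\<^sup>2)"
  proof (rule sum_mono)
    fix i
    have "1 * (x $ i / \<alpha> $ i)\<^sup>2 \<le> t\<^sup>2 * (x $ i / \<alpha> $ i)\<^sup>2"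
      using assms(2) by (intro mult_right_mono) (auto simp: one_le_power)
    then show "(x $ i / \<alpha> $ i)\<^sup>2 \<le> ((t *\<^sub>R x) $ i / \<alpha> $ i)\<^sup>2"
      by (simp add: power_divide power_mult_distrib)
  qed
  with assms(1) show ?thesis by (simp add: ellipsoid_def)
qed

text \<open>Moves the length of a vector into the semi-axes, so that only unit vectors have to be
  rotated.\<close>

lemma ellipsoid_rescale:
  assumes "r > 0"
  shows "x \<in> ellipsoid (s *\<^sub>R \<alpha>) \<longleftrightarrow> x /\<^sub>R r \<in> ellipsoid ((s / r) *\<^sub>R \<alpha>)"
  using assms by (simp add: ellipsoid_def field_simps)

text \<open>Source of the cut-off in the sum over primitive vectors. Each squared coordinate is the
  squared semi-axis times its term in the ellipsoid's sum, and these terms add up to at most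
  1.\<close>

lemma norm_le_ellipsoid:
  assumes "x \<in> ellipsoid (s *\<^sub>R \<alpha>)" "s > 0" "\<And>i. 0 < \<alpha> $ i" "\<And>i. \<alpha> $ i \<le> m"
  shows "norm x \<le> s * m"
proof -
  have m: "m \<ge> 0" using assms(3,4)[of undefined] by linarith
  have "(norm x)\<^sup>2 = (\<Sum>i\<in>UNIV. (x $ i)\<^sup>2)"
    by (simp add: norm_vec_def L2_set_def sum_nonneg)
  also have "\<dots> \<le> (\<Sum>i\<in>UNIV. (s * m)\<^sup>2 * (x $ i / (s *\<^sub>R \<alpha>) $ i)\<^sup>2)"
  proof (rule sum_mono)
    fix i
    have pos: "s * \<alpha> $ i > 0" using assms(2,3) by simp
    have "(x $ i)\<^sup>2 = (s * \<alpha> $ i)\<^sup>2 * (x $ i / (s * \<alpha> $ i))\<^sup>2"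
      using assms(2) assms(3)[of i] by (simp add: power_divide)
    also have "\<dots> \<le> (s * m)\<^sup>2 * (x $ i / (s * \<alpha> $ i))\<^sup>2"
      using assms(2) assms(4)[of i] pos by (intro mult_right_mono power_mono mult_left_mono) auto
    finally show "(x $ i)\<^sup>2 \<le> (s * m)\<^sup>2 * (x $ i / (s *\<^sub>R \<alpha>) $ i)\<^sup>2" by simp
  qed
  also have "\<dots> \<le> (s * m)\<^sup>2 * 1"
    unfolding sum_distrib_left[symmetric] using assms(1)
    by (intro mult_left_mono) (simp_all add: ellipsoid_def)
  finally have "(norm x)\<^sup>2 \<le> (s * m)\<^sup>2" by simp
  then show ?thesis by (rule power2_le_imp_le) (use m assms(2) in simp)
qed

text \<open>Since \<open>C\<close> contains the origin, the intersection is never empty and differs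
  from \<open>{0}\<close> only through a non-zero point. Such a point comes from a non-zero integer
  vector because \<open>P\<close> is injective.\<close>

lemma lattice_hit_iff:
  assumes P: "P \<in> orthogonal_group" and C: "0 \<in> C"
  shows "(\<lambda>z. P *v z) ` int_lattice \<inter> C \<noteq> {0} \<longleftrightarrow> (\<exists>a. a \<noteq> 0 \<and> P *v of_int_vec a \<in> C)"
proof -
  have nz: "P *v of_int_vec a = 0 \<longleftrightarrow> a = 0" for a
    by (simp add: orthogonal_group_eq_0[OF P])
  have "P *v of_int_vec 0 = 0" by (simp add: nz)
  then have "0 \<in> (\<lambda>z. P *v z) ` int_lattice \<inter> C"
    using C by (auto simp: int_lattice_def image_iff intro!: exI[of _ 0])
  then have "(\<lambda>z. P *v z) ` int_lattice \<inter> C \<noteq> {0} \<longleftrightarrow> (\<exists>y\<in>(\<lambda>z. P *v z) ` int_lattice \<inter> C. y \<noteq> 0)"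
    by blast
  then show ?thesis using nz by (auto simp: int_lattice_def)
qed

section \<open>Hitting probabilities of a random lattice\<close>

context
  fixes \<mu> :: "(real^'k^'k) measure"
  assumes haar: "haar_prob_O \<mu>"
begin

lemma hit_prob_eq:
  assumes "0 \<in> C"
  shows "hit_prob \<mu> C = measure \<mu> {P \<in> space \<mu>. \<exists>a. a \<noteq> 0 \<and> P *v of_int_vec a \<in> C}"
  unfolding hit_prob_def space_haar[OF haar]
  by (intro arg_cong[where f = "measure \<mu>"] Collect_cong conj_cong refl lattice_hit_iff assms)

text \<open>A countable union of Borel conditions. The predicate \<open>Q\<close> covers both the
  non-zero vectors and, for the hyperplane sections, those with a vanishing coordinate.\<close>

lemma hit_event_measurable:
  assumes "C \<in> sets borel"
  shows "{P \<in> space \<mu>. \<exists>a. Q a \<and> P *v of_int_vec a \<in> C} \<in> sets \<mu>"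
proof -
  note [measurable] = measurable_haar_borel[OF haar] assms
  have "{P \<in> space \<mu>. \<exists>a. Q a \<and> P *v of_int_vec a \<in> C} =
      (\<Union>a\<in>{a. Q a}. {P \<in> space \<mu>. P *v of_int_vec a \<in> C})"
    by auto
  moreover have "{P \<in> space \<mu>. P *v of_int_vec a \<in> C} \<in> sets \<mu>" for a by measurable
  then have "(\<Union>a\<in>{a. Q a}. {P \<in> space \<mu>. P *v of_int_vec a \<in> C}) \<in> sets \<mu>"
    by (intro sets.countable_UN'[OF countable_int_vectors]) auto
  ultimately show ?thesis by simp
qed

lemma hit_prob_le_1: "hit_prob \<mu> C \<le> 1"
  using prob_space_haar[OF haar] by (simp add: hit_prob_def prob_space.prob_le_1)

lemma measure_haar_ellipsoid:
  assumes "a \<noteq> 0"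
  shows "measure \<mu> {P \<in> space \<mu>. P *v of_int_vec a \<in> ellipsoid (s *\<^sub>R \<alpha>)} =
    sigma_tilde (ellipsoid ((s / norm (of_int_vec a)) *\<^sub>R \<alpha>))"
proof -
  have pos: "norm (of_int_vec a) > 0" using assms by simp
  have "{P \<in> space \<mu>. P *v of_int_vec a \<in> ellipsoid (s *\<^sub>R \<alpha>)} =
    {P \<in> space \<mu>. P *v (of_int_vec a /\<^sub>R norm (of_int_vec a)) \<in> ellipsoid ((s / norm (of_int_vec a)) *\<^sub>R \<alpha>)}"
    unfolding ellipsoid_rescale[OF pos, of _ s \<alpha>] matrix_vector_mult_scaleR ..
  then show ?thesis
    using measure_haar_orbit[OF haar, of "of_int_vec a /\<^sub>R norm (of_int_vec a)"
        "ellipsoid ((s / norm (of_int_vec a)) *\<^sub>R \<alpha>)"] assms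
    by (simp add: closed_ellipsoid borel_closed)
qed

lemma hit_prob_le_sum_primitive:
  assumes s: "s > 0" and \<alpha>: "\<And>i. 0 < \<alpha> $ i" "\<And>i. \<alpha> $ i \<le> m"
  shows "hit_prob \<mu> (ellipsoid (s *\<^sub>R \<alpha>)) \<le>
    (\<Sum>n\<in>{n :: int^'k. n \<in> primitive_vectors \<and> norm (of_int_vec n) \<le> s * m}.
      sigma_tilde (ellipsoid ((s / norm (of_int_vec n)) *\<^sub>R \<alpha>)))"
proof -
  interpret H: prob_space \<mu> by (rule prob_space_haar[OF haar])
  note [measurable] = measurable_haar_borel[OF haar] borel_closed[OF closed_ellipsoid]
  define N where "N = {n::int^'k. n \<in> primitive_vectors \<and> norm (of_int_vec n) \<le> s * m}"
  have fin: "finite N"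
    unfolding N_def by (rule finite_subset[OF _ finite_int_vectors_bounded[of "s * m"]]) auto
  define H where "H n = {P \<in> space \<mu>. P *v of_int_vec n \<in> ellipsoid (s *\<^sub>R \<alpha>)}" for n
  have H: "H n \<in> sets \<mu>" for n unfolding H_def by measurable
  \<comment> \<open>A hit by \<open>g\<close> times a primitive \<open>n\<close> is also a hit by
    \<open>n\<close>, and \<open>n\<close> obeys the norm bound because \<open>P\<close> preserves
    norms.\<close>
  have "{P \<in> space \<mu>. \<exists>a. a \<noteq> 0 \<and> P *v of_int_vec a \<in> ellipsoid (s *\<^sub>R \<alpha>)} \<subseteq> (\<Union>n\<in>N. H n)"
  proof clarify
    fix P :: "real^'k^'k" and a :: "int^'k"
    assume P: "P \<in> space \<mu>" and a: "a \<noteq> 0" "P *v of_int_vec a \<in> ellipsoid (s *\<^sub>R \<alpha>)"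
    obtain g n where n: "g \<ge> 1" "n \<in> primitive_vectors" "of_int_vec a = real_of_int g *\<^sub>R of_int_vec n"
      using primitive_decomposition[OF a(1)] .
    have E: "P *v of_int_vec n \<in> ellipsoid (s *\<^sub>R \<alpha>)"
      by (rule scaleR_in_ellipsoid[of "real_of_int g"])
         (use a(2) n in \<open>simp_all add: matrix_vector_mult_scaleR\<close>)
    then have "norm (of_int_vec n) \<le> s * m"
      using norm_le_ellipsoid[OF E s \<alpha>] P by (simp add: space_haar[OF haar] orthogonal_group_norm)
    then show "P \<in> (\<Union>n\<in>N. H n)" using n(2) E P by (auto simp: N_def H_def)
  qed
  then have "hit_prob \<mu> (ellipsoid (s *\<^sub>R \<alpha>)) \<le> measure \<mu> (\<Union>n\<in>N. H n)"
    unfolding hit_prob_eq[OF zero_in_ellipsoid]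
    by (rule H.finite_measure_mono) (use H fin in auto)
  also have "\<dots> \<le> (\<Sum>n\<in>N. measure \<mu> (H n))"
    by (rule H.finite_measure_subadditive_finite[OF fin]) (use H in auto)
  also have "\<dots> = (\<Sum>n\<in>N. sigma_tilde (ellipsoid ((s / norm (of_int_vec n)) *\<^sub>R \<alpha>)))"
    by (rule sum.cong) (auto simp: N_def H_def intro!: measure_haar_ellipsoid dest: primitive_nonzero)
  finally show ?thesis unfolding N_def .
qed

lemma sigma_tilde_le_hit_prob:
  "sigma_tilde (ellipsoid \<alpha>) \<le> hit_prob \<mu> (ellipsoid \<alpha>)"
proof -
  interpret H: prob_space \<mu> by (rule prob_space_haar[OF haar])
  \<comment> \<open>Any standard basis vector serves: it is an integer vector of length 1, so its
    image is uniform on the sphere without rescaling. \<open>undefined\<close> is just some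
    coordinate.\<close>
  define e :: "int^'k" where "e = axis undefined 1"
  have e: "of_int_vec e = axis undefined 1" "e \<noteq> 0"
    by (auto simp: e_def of_int_vec_def axis_def vec_eq_iff)
  have "sigma_tilde (ellipsoid \<alpha>) = measure \<mu> {P \<in> space \<mu>. P *v of_int_vec e \<in> ellipsoid \<alpha>}"
    by (rule measure_haar_orbit[OF haar, symmetric]) (simp_all add: e borel_closed closed_ellipsoid)
  also have "\<dots> \<le> hit_prob \<mu> (ellipsoid \<alpha>)"
    unfolding hit_prob_eq[OF zero_in_ellipsoid]
    using e(2) by (intro H.finite_measure_mono hit_event_measurable borel_closed closed_ellipsoid) auto
  finally show ?thesis .
qed

end

section \<open>Hyperplane sections\<close>

text \<open>For \<open>w = 0\<close> the quotient is \<open>0 / 0 = 0\<close> and the map is the identity.\<close>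

lemma orthogonal_transformation_reflection:
  fixes w :: "'a::real_inner"
  shows "orthogonal_transformation (\<lambda>x. x - (2 * (w \<bullet> x) / (w \<bullet> w)) *\<^sub>R w)"
proof (cases "w = 0")
  case False
  then have "w \<bullet> w \<noteq> 0" by simp
  then show ?thesis
    unfolding orthogonal_transformation_def
    by (auto intro!: linearI simp: inner_diff inner_add inner_commute algebra_simps
        add_divide_distrib power2_eq_square)
qed (simp add: orthogonal_transformation_id[unfolded id_def])

text \<open>Supplies an orthogonal map from \<open>e\<close> to \<open>v\<close> by a formula
  explicit in \<open>v\<close>, as needed for measurability in \<open>v\<close>. Equal norms make
  the coefficient -1 when \<open>v\<close> differs from \<open>e\<close>.\<close>

lemma reflection_swaps:
  fixes e v :: "'a::real_inner"
  assumes "norm e = 1" "norm v = 1"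
  shows "e - (2 * ((v - e) \<bullet> e) / ((v - e) \<bullet> (v - e))) *\<^sub>R (v - e) = v"
proof (cases "v = e")
  case False
  have "(v - e) \<bullet> (v - e) = - 2 * ((v - e) \<bullet> e)"
    using assms by (simp add: inner_diff inner_commute norm_eq_1)
  moreover have "(v - e) \<bullet> (v - e) \<noteq> 0" using False by simp
  ultimately have "2 * ((v - e) \<bullet> e) / ((v - e) \<bullet> (v - e)) = -1" by (simp add: divide_simps)
  then show ?thesis by simp
qed simp

text \<open>Preserving inner products, \<open>g\<close> carries the orthogonal complement of
  \<open>v\<close> onto that of \<open>g v\<close>. It is applied to the reflections and to the Haar
  matrix itself.\<close>

lemma hyperplane_isometry_compose:
  fixes g :: "real^'n \<Rightarrow> real^'n"
  assumes f: "hyperplane_isometry v f" and g: "orthogonal_transformation g"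
  shows "hyperplane_isometry (g v) (\<lambda>x. g (f x))"
proof -
  have "g ` hyperplane v = hyperplane (g v)"
  proof safe
    fix y assume "y \<in> hyperplane (g v)"
    moreover obtain x where "y = g x" using orthogonal_transformation_surj[OF g] by (metis surjD)
    ultimately show "y \<in> g ` hyperplane v"
      using g by (auto simp: hyperplane_def orthogonal_transformation_def)
  qed (use g in \<open>auto simp: hyperplane_def orthogonal_transformation_def\<close>)
  moreover have "range (\<lambda>x. g (f x)) = g ` range f" by auto
  ultimately show ?thesis
    using f orthogonal_transformation_linear[OF g] linear_compose[of f g]
    by (simp add: hyperplane_isometry_def orthogonal_transformation_norm[OF g] o_def)
qed

section \<open>Coordinate hyperplanes and block matrices\<close>

definition coord_embed :: "'n \<Rightarrow> ('m \<Rightarrow> 'n) \<Rightarrow> 'a::zero^'m \<Rightarrow> 'a^'n" where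
  "coord_embed k b x = (\<chi> i. if i = k then 0 else x $ inv b i)"

definition coord_project :: "('m \<Rightarrow> 'n) \<Rightarrow> real^'n \<Rightarrow> real^'m" where
  "coord_project b y = (\<chi> j. y $ b j)"

text \<open>The block-diagonal matrix with entry 1 at \<open>k\<close> and block \<open>R\<close> on
  the other coordinates, which embeds the orthogonal group of the smaller dimension as matrices
  fixing the \<open>k\<close>-th axis. Passing through a linear map avoids case distinctions on two
  indices.\<close>

definition block_matrix :: "'n \<Rightarrow> ('m \<Rightarrow> 'n) \<Rightarrow> real^'m^'m \<Rightarrow> real^'n^'n" where
  "block_matrix k b R =
     matrix (\<lambda>y. (y $ k) *\<^sub>R axis k 1 + coord_embed k b (R *v coord_project b y))"

lemma linear_coord_embed: "linear (coord_embed k b :: real^'m \<Rightarrow> real^'n)"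
  by (rule linearI) (auto simp: coord_embed_def vec_eq_iff)

lemma linear_coord_project: "linear (coord_project b)"
  by (rule linearI) (auto simp: coord_project_def vec_eq_iff)

lemma coord_embed_k [simp]: "coord_embed k b x $ k = 0"
  by (simp add: coord_embed_def)

context
  fixes k :: "'n::finite" and b :: "'m::finite \<Rightarrow> 'n"
  assumes b: "bij_betw b UNIV (UNIV - {k})"
begin

lemma inv_b [simp]: "inv b (b j) = j"
  using b by (auto simp: bij_betw_def)

lemma b_neq [simp]: "b j \<noteq> k"
  using b by (auto simp: bij_betw_def)

lemma b_inv [simp]: "i \<noteq> k \<Longrightarrow> b (inv b i) = i"
  using b by (auto simp: bij_betw_def intro!: f_inv_into_f)

lemma sum_split_coord: "(\<Sum>i\<in>UNIV. h i) = h k + (\<Sum>j\<in>UNIV. h (b j))" for h :: "'n \<Rightarrow> real"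
proof -
  have "(\<Sum>i\<in>UNIV. h i) = h k + (\<Sum>i\<in>UNIV - {k}. h i)" by (simp add: sum.remove)
  also have "(\<Sum>i\<in>UNIV - {k}. h i) = (\<Sum>j\<in>UNIV. h (b j))"
    using sum.reindex_bij_betw[OF b, of h] by simp
  finally show ?thesis .
qed

lemma norm_coord_split: "(norm y)\<^sup>2 = (y $ k)\<^sup>2 + (norm (coord_project b y))\<^sup>2"
  by (simp add: norm_vec_def L2_set_def sum_nonneg sum_split_coord coord_project_def)

lemma coord_project_embed [simp]: "coord_project b (coord_embed k b x) = x"
  by (simp add: coord_project_def coord_embed_def vec_eq_iff)

lemma coord_embed_project: "y $ k = 0 \<Longrightarrow> coord_embed k b (coord_project b y) = y"
  by (auto simp: coord_project_def coord_embed_def vec_eq_iff)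

lemma norm_coord_embed: "norm (coord_embed k b x) = norm (x :: real^'m)"
  using norm_coord_split[of "coord_embed k b x"] by (simp add: power2_eq_iff_nonneg)

text \<open>The reason for the polymorphic \<open>coord_embed\<close>: the smaller integer lattice
  becomes the integer vectors with \<open>k\<close>-th coordinate zero.\<close>

lemma coord_embed_of_int: "coord_embed k b (of_int_vec a) = of_int_vec (coord_embed k b a)"
  by (auto simp: coord_embed_def of_int_vec_def vec_eq_iff)

lemma coord_embed_eq_0: "coord_embed k b a = 0 \<longleftrightarrow> (a :: int^'m) = 0"
  by (metis coord_embed_of_int norm_coord_embed norm_eq_zero of_int_vec_eq_0)

lemma hyperplane_isometry_coord_embed: "hyperplane_isometry (axis k 1) (coord_embed k b)"
proof -
  have "y \<in> range (coord_embed k b)" if "y $ k = 0" for y :: "real^'n"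
    using coord_embed_project[OF that] by (metis rangeI)
  then show ?thesis
    by (auto simp: hyperplane_isometry_def linear_coord_embed norm_coord_embed hyperplane_def
        inner_axis' inner_axis)
qed

lemma block_matrix_mult:
  "block_matrix k b R *v y = (y $ k) *\<^sub>R axis k 1 + coord_embed k b (R *v coord_project b y)"
proof -
  have "linear (\<lambda>y. (y $ k) *\<^sub>R axis k 1 + coord_embed k b (R *v coord_project b y))"
    by (rule linearI)
       (simp_all add: linear_add[OF linear_coord_embed] linear_scale[OF linear_coord_embed]
         linear_add[OF linear_coord_project] linear_scale[OF linear_coord_project]
         matrix_vector_right_distrib matrix_vector_mult_scaleR algebra_simps)
  then show ?thesis by (simp add: block_matrix_def matrix_works)
qed

text \<open>Turns a rotation inside the hyperplane into right multiplication by a full-size matrix,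
  which right invariance can absorb.\<close>

lemma block_matrix_embed: "block_matrix k b R *v coord_embed k b x = coord_embed k b (R *v x)"
  by (simp add: block_matrix_mult)

lemma block_matrix_orthogonal:
  assumes R: "R \<in> orthogonal_group"
  shows "block_matrix k b R \<in> orthogonal_group"
proof -
  have "norm (block_matrix k b R *v y) = norm y" for y
  proof -
    have "(norm (block_matrix k b R *v y))\<^sup>2 = (norm y)\<^sup>2"
      using R unfolding norm_coord_split block_matrix_mult
      by (simp add: linear_add[OF linear_coord_project] orthogonal_group_norm)
         (simp add: coord_project_def axis_def orthogonal_group_norm flip: zero_vec_def)
    then show ?thesis by (simp add: power2_eq_iff_nonneg)
  qed
  then have "orthogonal_transformation ((*v) (block_matrix k b R))"
    by (simp add: orthogonal_transformation)
  then show ?thesis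
    by (metis matrix_of_matrix_vector_mul mem_Collect_eq orthogonal_group_def
        orthogonal_transformation_matrix)
qed

end

text \<open>Replaces the isometry chosen by \<open>SOME\<close> with any convenient one. The
  intersection with the hyperplane disappears because \<open>f\<close> maps into it.\<close>

lemma hit_prob_slice_eq_measure:
  fixes f :: "real^'m \<Rightarrow> real^'n"
  assumes haar: "haar_prob_O (\<mu> :: (real^'m^'m) measure)"
    and f: "hyperplane_isometry v f" and C: "closed C" "0 \<in> C"
  shows "hit_prob_slice \<mu> C v =
    measure \<mu> {P \<in> space \<mu>. \<exists>a. a \<noteq> 0 \<and> f (P *v of_int_vec a) \<in> C}"
proof -
  have "f 0 = 0" using f by (simp add: hyperplane_isometry_def linear_0)
  then have "0 \<in> f -` (C \<inter> hyperplane v)" using C by (simp add: hyperplane_def)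
  moreover have "f x \<in> hyperplane v" for x using f by (auto simp: hyperplane_isometry_def)
  ultimately show ?thesis
    by (simp add: hit_prob_slice_eq[OF haar f C] hit_prob_eq[OF haar])
qed

lemma hit_prob_slice_bounds:
  assumes "haar_prob_O \<mu>"
  shows "0 \<le> hit_prob_slice \<mu> C v" "hit_prob_slice \<mu> C v \<le> 1"
  using hit_prob_le_1[OF assms] by (simp_all add: hit_prob_slice_def) (simp add: hit_prob_def)

lemma borel_measurable_hyperplane_isometry:
  "hyperplane_isometry v f \<Longrightarrow> f \<in> borel \<rightarrow>\<^sub>M borel"
  by (intro borel_measurable_continuous_onI linear_continuous_on)
     (simp add: hyperplane_isometry_def linear_conv_bounded_linear)

lemma obtain_coord_bij:
  assumes card: "CARD('m::finite) = CARD('n::finite) - 1"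
  obtains b :: "'m::finite \<Rightarrow> 'n::finite" where "bij_betw b UNIV (UNIV - {k})"
proof -
  have "card (UNIV :: 'm set) = card (UNIV - {k} :: 'n set)" using card by simp
  then show ?thesis using that by (metis finite_same_card_bij finite)
qed

section \<open>Averaging the section probability over the sphere\<close>

context
  fixes \<mu>' :: "(real^'m^'m) measure" and C :: "(real^'n) set"
  assumes haar': "haar_prob_O \<mu>'"
    and card: "CARD('m) = CARD('n) - 1" and C: "closed C" "0 \<in> C"
begin

text \<open>The isometry in the definition is chosen separately for each \<open>v\<close>, with no
  control on its dependence on \<open>v\<close>. It is replaced by \<open>f v\<close>, the
  coordinate embedding followed by the reflection exchanging \<open>e\<close> and \<open>v\<close>,
  which is jointly Borel; the value is then the measure of a section of \<open>X\<close>.\<close>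

lemma borel_measurable_hit_prob_slice:
  "hit_prob_slice \<mu>' C \<in> borel_measurable sphere_area"
proof -
  interpret H': prob_space \<mu>' by (rule prob_space_haar[OF haar'])
  note [measurable] = measurable_haar_borel[OF haar'] borel_closed[OF C(1)]
  define k :: 'n where "k = undefined"
  obtain b :: "'m \<Rightarrow> 'n" where b: "bij_betw b UNIV (UNIV - {k})" by (rule obtain_coord_bij[OF card])
  note iso = hyperplane_isometry_coord_embed[OF b]
  note [measurable] = borel_measurable_hyperplane_isometry[OF iso]
  define e :: "real^'n" where "e = axis k 1"
  have e: "norm e = 1" by (simp add: e_def)
  define f where "f v x = coord_embed k b x -
      (2 * ((v - e) \<bullet> coord_embed k b x) / ((v - e) \<bullet> (v - e))) *\<^sub>R (v - e)" for v x
  have f: "hyperplane_isometry v (f v)" if "norm v = 1" for v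
    using hyperplane_isometry_compose[OF iso orthogonal_transformation_reflection[of "v - e"]]
    unfolding f_def by (simp add: reflection_swaps[OF e that] flip: e_def)
  define X where "X = {(v, P) \<in> space (sphere_area \<Otimes>\<^sub>M \<mu>'). \<exists>a. a \<noteq> 0 \<and> f v (P *v of_int_vec a) \<in> C}"
  have "{x \<in> space (sphere_area \<Otimes>\<^sub>M \<mu>'). f (fst x) (snd x *v of_int_vec a) \<in> C}
      \<in> sets (sphere_area \<Otimes>\<^sub>M \<mu>')" for a
    unfolding f_def by measurable
  then have "(\<Union>a\<in>{a. a \<noteq> 0}. {x \<in> space (sphere_area \<Otimes>\<^sub>M \<mu>'). f (fst x) (snd x *v of_int_vec a) \<in> C})
      \<in> sets (sphere_area \<Otimes>\<^sub>M \<mu>')"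
    by (intro sets.countable_UN'[OF countable_int_vectors]) auto
  also have "(\<Union>a\<in>{a. a \<noteq> 0}. {x \<in> space (sphere_area \<Otimes>\<^sub>M \<mu>'). f (fst x) (snd x *v of_int_vec a) \<in> C}) = X"
    by (auto simp: X_def)
  finally have "(\<lambda>v. enn2real (emeasure \<mu>' (Pair v -` X))) \<in> borel_measurable sphere_area"
    using H'.measurable_emeasure_Pair by measurable
  also have "?this \<longleftrightarrow> ?thesis"
  proof (rule measurable_cong)
    fix v :: "real^'n" assume v: "v \<in> space sphere_area"
    then have "Pair v -` X = {P \<in> space \<mu>'. \<exists>a. a \<noteq> 0 \<and> f v (P *v of_int_vec a) \<in> C}"
      by (auto simp: X_def space_pair_measure)
    then show "enn2real (emeasure \<mu>' (Pair v -` X)) = hit_prob_slice \<mu>' C v"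
      using v by (simp add: hit_prob_slice_eq_measure[OF haar' f C] space_sphere_area measure_def)
  qed
  finally show ?thesis .
qed

text \<open>Guarantees that the integral in the lower bound is a genuine one and not the default
  value 0 of the Bochner integral.\<close>

lemma integrable_hit_prob_slice: "integrable sphere_area (hit_prob_slice \<mu>' C)"
proof -
  interpret S: finite_measure "sphere_area :: (real^'n) measure" by (rule finite_measure_sphere_area)
  show ?thesis
    by (rule S.integrable_const_bound[of _ 1])
       (simp_all add: hit_prob_slice_bounds[OF haar'] borel_measurable_hit_prob_slice)
qed

text \<open>Two independent Haar matrices, \<open>P\<close> in the full dimension and
  \<open>R\<close> in the smaller one, are combined: the measure of one event \<open>X\<close> is
  computed by conditioning on either.\<close>

lemma integral_hit_prob_slice:
  fixes \<mu> :: "(real^'n^'n) measure"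
  assumes haar: "haar_prob_O \<mu>"
  shows "(\<integral>v. hit_prob_slice \<mu>' C v \<partial>sphere_area) / total_sphere_area CARD('n) =
     measure \<mu> {P \<in> space \<mu>. \<exists>a. (a \<noteq> 0 \<and> a $ k = 0) \<and> P *v of_int_vec a \<in> C}"
proof -
  interpret H: prob_space \<mu> by (rule prob_space_haar[OF haar])
  interpret H': prob_space \<mu>' by (rule prob_space_haar[OF haar'])
  interpret pair_prob_space \<mu> \<mu>' ..
  note [measurable] = measurable_haar_borel[OF haar] measurable_haar_borel[OF haar'] borel_closed[OF C(1)]
  obtain b :: "'m \<Rightarrow> 'n" where b: "bij_betw b UNIV (UNIV - {k})" by (rule obtain_coord_bij[OF card])
  note iso = hyperplane_isometry_coord_embed[OF b]
  note [measurable] = borel_measurable_hyperplane_isometry[OF iso]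
  define T where "T = {P \<in> space \<mu>. \<exists>a. (a \<noteq> 0 \<and> a $ k = 0) \<and> P *v of_int_vec a \<in> C}"
  have T: "T \<in> sets \<mu>" unfolding T_def by (rule hit_event_measurable[OF haar borel_closed[OF C(1)]])
  have int_project: "\<exists>a'. a = coord_embed k b a'" if "a $ k = 0" for a :: "int^'n"
    using that b_inv[OF b] by (intro exI[of _ "\<chi> j. a $ b j"]) (auto simp: coord_embed_def vec_eq_iff)
  have T_eq: "T = {P \<in> space \<mu>. \<exists>a. a \<noteq> 0 \<and> P *v coord_embed k b (of_int_vec a) \<in> C}"
    unfolding T_def coord_embed_of_int[OF b]
    using int_project coord_embed_eq_0[OF b] coord_embed_k by (metis (no_types, opaque_lifting))
  define X where "X = {(P, R) \<in> space (\<mu> \<Otimes>\<^sub>M \<mu>'). \<exists>a. a \<noteq> 0 \<and> P *v coord_embed k b (R *v of_int_vec a) \<in> C}"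
  have "{x \<in> space (\<mu> \<Otimes>\<^sub>M \<mu>'). fst x *v coord_embed k b (snd x *v of_int_vec a) \<in> C}
      \<in> sets (\<mu> \<Otimes>\<^sub>M \<mu>')" for a
    by measurable
  then have "(\<Union>a\<in>{a. a \<noteq> 0}. {x \<in> space (\<mu> \<Otimes>\<^sub>M \<mu>'). fst x *v coord_embed k b (snd x *v of_int_vec a) \<in> C})
      \<in> sets (\<mu> \<Otimes>\<^sub>M \<mu>')"
    by (intro sets.countable_UN'[OF countable_int_vectors]) auto
  also have "(\<Union>a\<in>{a. a \<noteq> 0}. {x \<in> space (\<mu> \<Otimes>\<^sub>M \<mu>'). fst x *v coord_embed k b (snd x *v of_int_vec a) \<in> C}) = X"
    by (auto simp: X_def)
  finally have X: "X \<in> sets (\<mu> \<Otimes>\<^sub>M \<mu>')" .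
  have "emeasure (\<mu> \<Otimes>\<^sub>M \<mu>') X = (\<integral>\<^sup>+R. emeasure \<mu> ((\<lambda>P. (P, R)) -` X) \<partial>\<mu>')"
    by (rule emeasure_pair_measure_alt2[OF X])
  \<comment> \<open>For fixed \<open>R\<close> the section is the event \<open>T\<close> with
    \<open>P\<close> multiplied on the right by an orthogonal block matrix.\<close>
  also have "\<dots> = (\<integral>\<^sup>+R. emeasure \<mu> T \<partial>\<mu>')"
  proof (rule nn_integral_cong)
    fix R assume R: "R \<in> space \<mu>'"
    then have Q: "block_matrix k b R \<in> orthogonal_group"
      using block_matrix_orthogonal[OF b] by (simp add: space_haar[OF haar'])
    have "(\<lambda>P. (P, R)) -` X = {P \<in> space \<mu>. P ** block_matrix k b R \<in> T}"
      using R Q by (auto simp: X_def T_eq space_pair_measure block_matrix_embed[OF b]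
          space_haar[OF haar] orthogonal_group_mult simp flip: matrix_vector_mul_assoc)
    then show "emeasure \<mu> ((\<lambda>P. (P, R)) -` X) = emeasure \<mu> T"
      using haar_right_invariant[OF haar Q T] by simp
  qed
  also have "\<dots> = emeasure \<mu> T" by (simp add: H'.emeasure_space_1)
  finally have "emeasure \<mu> T = (\<integral>\<^sup>+P. emeasure \<mu>' (Pair P -` X) \<partial>\<mu>)"
    using H'.emeasure_pair_measure_alt[OF X] by simp
  \<comment> \<open>For fixed \<open>P\<close>, the embedding followed by \<open>P\<close> is an
    isometry onto the hyperplane orthogonal to \<open>P *v axis k 1\<close>, so the section has the
    slice probability of that hyperplane.\<close>
  also have "\<dots> = (\<integral>\<^sup>+P. ennreal (hit_prob_slice \<mu>' C (P *v axis k 1)) \<partial>\<mu>)"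
  proof (rule nn_integral_cong)
    fix P assume P: "P \<in> space \<mu>"
    then have "orthogonal_transformation ((*v) P)"
      by (simp add: space_haar[OF haar] orthogonal_group_transformation)
    from hyperplane_isometry_compose[OF iso this]
    have "hit_prob_slice \<mu>' C (P *v axis k 1) =
      measure \<mu>' {R \<in> space \<mu>'. \<exists>a. a \<noteq> 0 \<and> P *v coord_embed k b (R *v of_int_vec a) \<in> C}"
      by (rule hit_prob_slice_eq_measure[OF haar' _ C])
    also have "{R \<in> space \<mu>'. \<exists>a. a \<noteq> 0 \<and> P *v coord_embed k b (R *v of_int_vec a) \<in> C} = Pair P -` X"
      using P by (auto simp: X_def space_pair_measure)
    finally show "emeasure \<mu>' (Pair P -` X) = ennreal (hit_prob_slice \<mu>' C (P *v axis k 1))"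
      by (simp add: H'.emeasure_eq_measure)
  qed
  \<comment> \<open>The normal vector \<open>P *v axis k 1\<close> is uniform on the sphere, which
    turns the Haar integral into the surface integral.\<close>
  finally have "emeasure \<mu> T * ennreal (total_sphere_area CARD('n)) =
      (\<integral>\<^sup>+v. ennreal (hit_prob_slice \<mu>' C v) \<partial>sphere_area)"
    using nn_integral_haar_orbit[OF haar, of "axis k 1" "\<lambda>v. ennreal (hit_prob_slice \<mu>' C v)"]
      borel_measurable_hit_prob_slice by simp
  also have "\<dots> = ennreal (\<integral>v. hit_prob_slice \<mu>' C v \<partial>sphere_area)"
    by (rule nn_integral_eq_integral[OF integrable_hit_prob_slice]) (simp add: hit_prob_slice_bounds[OF haar'])
  finally have "measure \<mu> T * total_sphere_area CARD('n) = (\<integral>v. hit_prob_slice \<mu>' C v \<partial>sphere_area)"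
    using total_sphere_area_pos[of "CARD('n)"]
    by (simp add: H.emeasure_eq_measure integral_nonneg hit_prob_slice_bounds[OF haar'] flip: ennreal_mult)
  then show ?thesis
    using total_sphere_area_pos[of "CARD('n)"] by (simp add: T_def field_simps)
qed

text \<open>The average equals the probability of a hit by a lattice vector with one prescribed
  coordinate zero, a special case of a hit.\<close>

lemma integral_hit_prob_slice_le_hit_prob:
  fixes \<mu> :: "(real^'n^'n) measure"
  assumes haar: "haar_prob_O \<mu>"
  shows "(\<integral>v. hit_prob_slice \<mu>' C v \<partial>sphere_area) / total_sphere_area CARD('n) \<le> hit_prob \<mu> C"
proof -
  interpret H: prob_space \<mu> by (rule prob_space_haar[OF haar])
  show ?thesis
    unfolding integral_hit_prob_slice[OF haar, of undefined] hit_prob_eq[OF haar C(2)]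
    by (intro H.finite_measure_mono hit_event_measurable[OF haar] borel_closed C) auto
qed

end

section \<open>The measure of the set of pairs\<close>

text \<open>Links the image of a ball in \<open>frakF\<close> with the ellipsoid in the bounds. At a
  point \<open>D *v x\<close> the ellipsoid's sum becomes the squared norm of \<open>x\<close>
  divided by \<delta>, and every point has this form because the diagonal is positive.\<close>

lemma diag_image_cball:
  assumes D: "D \<in> Delta_pp" and d: "\<delta> > 0"
  shows "(\<lambda>x. D *v x) ` cball 0 (sqrt \<delta>) = ellipsoid (sqrt \<delta> *\<^sub>R diag_vec D)"
proof -
  have pos: "D $ i $ i > 0" for i using D by (simp add: Delta_pp_def)
  have mult: "(D *v x) $ i = D $ i $ i * x $ i" for x i
  proof -
    have "D $ i $ j * x $ j = (if j = i then D $ i $ i * x $ i else 0)" for j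
      using D by (simp add: Delta_pp_def)
    then have "(\<Sum>j\<in>UNIV. D $ i $ j * x $ j) = (\<Sum>j\<in>UNIV. if j = i then D $ i $ i * x $ i else 0)"
      by (intro sum.cong refl)
    then show ?thesis by (simp add: matrix_vector_mult_def)
  qed
  have iff: "D *v x \<in> ellipsoid (sqrt \<delta> *\<^sub>R diag_vec D) \<longleftrightarrow> x \<in> cball 0 (sqrt \<delta>)" for x
  proof -
    have "(\<Sum>i\<in>UNIV. ((D *v x) $ i / (sqrt \<delta> *\<^sub>R diag_vec D) $ i)\<^sup>2) = (\<Sum>i\<in>UNIV. (x $ i)\<^sup>2 / \<delta>)"
    proof (rule sum.cong)
      fix i
      show "((D *v x) $ i / (sqrt \<delta> *\<^sub>R diag_vec D) $ i)\<^sup>2 = (x $ i)\<^sup>2 / \<delta>"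
        using pos[of i] d by (simp add: mult diag_vec_def power_divide power_mult_distrib)
    qed simp
    also have "\<dots> = (norm x)\<^sup>2 / \<delta>"
      by (simp add: norm_vec_def L2_set_def sum_nonneg sum_divide_distrib)
    also have "\<dots> \<le> 1 \<longleftrightarrow> norm x \<le> sqrt \<delta>"
      using d real_sqrt_le_iff[of "(norm x)\<^sup>2" \<delta>] by simp
    finally show ?thesis by (simp add: ellipsoid_def)
  qed
  have surj: "D *v (\<chi> i. y $ i / D $ i $ i) = y" for y
    using pos by (simp add: vec_eq_iff mult less_imp_neq[THEN not_sym])
  show ?thesis
  proof (intro equalityI subsetI)
    fix y assume y: "y \<in> ellipsoid (sqrt \<delta> *\<^sub>R diag_vec D)"
    show "y \<in> (\<lambda>x. D *v x) ` cball 0 (sqrt \<delta>)"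
    proof (rule image_eqI)
      show "y = D *v (\<chi> i. y $ i / D $ i $ i)" by (rule surj[symmetric])
      show "(\<chi> i. y $ i / D $ i $ i) \<in> cball 0 (sqrt \<delta>)"
        using y iff[of "\<chi> i. y $ i / D $ i $ i"] unfolding surj by (rule iffD1[rotated])
    qed
  next
    fix y assume "y \<in> (\<lambda>x. D *v x) ` cball 0 (sqrt \<delta>)"
    then show "y \<in> ellipsoid (sqrt \<delta> *\<^sub>R diag_vec D)"
      by (rule imageE) (simp only: iff)
  qed
qed

context
  fixes \<mu> \<nu> :: "(real^'n^'n) measure" and \<delta> :: real
  assumes haar: "haar_prob_O \<mu>"
    and sets: "sets \<nu> = sets (restrict_space borel Delta_pp)" and d: "\<delta> > 0"
begin

lemma space_diag: "space \<nu> = Delta_pp"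
  using sets_eq_imp_space_eq[OF sets] by (simp add: space_restrict_space)

lemma frakF_eq:
  "frakF \<delta> = {(P, D) \<in> space (\<mu> \<Otimes>\<^sub>M \<nu>).
     \<exists>a. a \<noteq> 0 \<and> P *v of_int_vec a \<in> ellipsoid (sqrt \<delta> *\<^sub>R diag_vec D)}"
proof -
  have "(P, D) \<in> frakF \<delta> \<longleftrightarrow> P \<in> space \<mu> \<and> D \<in> space \<nu> \<and>
      (\<exists>a. a \<noteq> 0 \<and> P *v of_int_vec a \<in> ellipsoid (sqrt \<delta> *\<^sub>R diag_vec D))" for P D :: "real^'n^'n"
  proof (cases "P \<in> orthogonal_group \<and> D \<in> Delta_pp")
    case True
    then show ?thesis
      using lattice_hit_iff[of P, OF _ zero_in_ellipsoid] diag_image_cball[OF _ d, of D]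
      by (simp add: frakF_def space_diag space_haar[OF haar])
  qed (auto simp: frakF_def space_diag space_haar[OF haar])
  then show ?thesis by (auto simp: space_pair_measure)
qed

lemma frakF_measurable: "frakF \<delta> \<in> sets (\<mu> \<Otimes>\<^sub>M \<nu>)"
proof -
  note [measurable] = measurable_haar_borel[OF haar]
  have [measurable]: "(\<lambda>D. D) \<in> \<nu> \<rightarrow>\<^sub>M borel"
    unfolding measurable_cong_sets[OF sets refl] by (rule measurable_restrict_space1) simp
  \<comment> \<open>The ellipsoid varies with the second component, so membership is spelt out as an
    inequality between Borel functions of the pair.\<close>
  have "{x \<in> space (\<mu> \<Otimes>\<^sub>M \<nu>).
      (\<Sum>i\<in>UNIV. ((fst x *v of_int_vec a) $ i / (sqrt \<delta> * snd x $ i $ i))\<^sup>2) \<le> 1} \<in> sets (\<mu> \<Otimes>\<^sub>M \<nu>)" for a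
    by measurable
  then have "(\<Union>a\<in>{a. a \<noteq> 0}. {x \<in> space (\<mu> \<Otimes>\<^sub>M \<nu>).
      (\<Sum>i\<in>UNIV. ((fst x *v of_int_vec a) $ i / (sqrt \<delta> * snd x $ i $ i))\<^sup>2) \<le> 1}) \<in> sets (\<mu> \<Otimes>\<^sub>M \<nu>)"
    by (intro sets.countable_UN'[OF countable_int_vectors]) auto
  also have "(\<Union>a\<in>{a. a \<noteq> 0}. {x \<in> space (\<mu> \<Otimes>\<^sub>M \<nu>).
      (\<Sum>i\<in>UNIV. ((fst x *v of_int_vec a) $ i / (sqrt \<delta> * snd x $ i $ i))\<^sup>2) \<le> 1}) = frakF \<delta>"
    unfolding frakF_eq by (auto simp: ellipsoid_def diag_vec_def)
  finally show ?thesis .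
qed

lemma emeasure_frakF_section:
  assumes "D \<in> space \<nu>"
  shows "emeasure \<mu> ((\<lambda>P. (P, D)) -` frakF \<delta>) =
    ennreal (hit_prob \<mu> (ellipsoid (sqrt \<delta> *\<^sub>R diag_vec D)))"
proof -
  interpret H: prob_space \<mu> by (rule prob_space_haar[OF haar])
  have "(\<lambda>P. (P, D)) -` frakF \<delta> =
      {P \<in> space \<mu>. \<exists>a. a \<noteq> 0 \<and> P *v of_int_vec a \<in> ellipsoid (sqrt \<delta> *\<^sub>R diag_vec D)}"
    using assms by (auto simp: frakF_eq space_pair_measure)
  then show ?thesis by (simp add: hit_prob_eq[OF haar zero_in_ellipsoid] H.emeasure_eq_measure)
qed

text \<open>As a function of \<open>D\<close> the hitting probability is the measure of a section of
  \<open>frakF \<delta>\<close>, hence measurable, and it is bounded by 1.\<close>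

lemma integrable_hit_prob_ellipsoid:
  assumes prob: "prob_space \<nu>"
  shows "integrable \<nu> (\<lambda>D. hit_prob \<mu> (ellipsoid (sqrt \<delta> *\<^sub>R diag_vec D)))"
proof -
  interpret H: prob_space \<mu> by (rule prob_space_haar[OF haar])
  interpret N: prob_space \<nu> by (rule prob)
  interpret pair_prob_space \<mu> \<nu> ..
  have "(\<lambda>D. enn2real (emeasure \<mu> ((\<lambda>P. (P, D)) -` frakF \<delta>))) \<in> borel_measurable \<nu>"
    using measurable_emeasure_Pair2[OF frakF_measurable] by measurable
  also have "?this \<longleftrightarrow> (\<lambda>D. hit_prob \<mu> (ellipsoid (sqrt \<delta> *\<^sub>R diag_vec D))) \<in> borel_measurable \<nu>"
    by (rule measurable_cong) (simp add: emeasure_frakF_section, simp add: hit_prob_def)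
  finally show ?thesis
    by (intro N.integrable_const_bound[of _ 1])
       (simp_all add: hit_prob_le_1[OF haar], simp add: hit_prob_def)
qed

lemma measure_frakF:
  assumes prob: "prob_space \<nu>"
  shows "measure (\<mu> \<Otimes>\<^sub>M \<nu>) (frakF \<delta>) =
     (\<integral>D. hit_prob \<mu> (ellipsoid (sqrt \<delta> *\<^sub>R diag_vec D)) \<partial>\<nu>)"
proof -
  interpret H: prob_space \<mu> by (rule prob_space_haar[OF haar])
  interpret N: prob_space \<nu> by (rule prob)
  interpret pair_prob_space \<mu> \<nu> ..
  have "emeasure (\<mu> \<Otimes>\<^sub>M \<nu>) (frakF \<delta>) =
      (\<integral>\<^sup>+D. emeasure \<mu> ((\<lambda>P. (P, D)) -` frakF \<delta>) \<partial>\<nu>)"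
    by (rule emeasure_pair_measure_alt2[OF frakF_measurable])
  also have "\<dots> = (\<integral>\<^sup>+D. ennreal (hit_prob \<mu> (ellipsoid (sqrt \<delta> *\<^sub>R diag_vec D))) \<partial>\<nu>)"
    by (rule nn_integral_cong) (rule emeasure_frakF_section)
  also have "\<dots> = ennreal (\<integral>D. hit_prob \<mu> (ellipsoid (sqrt \<delta> *\<^sub>R diag_vec D)) \<partial>\<nu>)"
    by (rule nn_integral_eq_integral[OF integrable_hit_prob_ellipsoid[OF prob]]) (simp add: hit_prob_def)
  finally show ?thesis
    by (simp add: measure_def integral_nonneg hit_prob_def)
qed

end

section \<open>Assembly of the integral formula and the bounds\<close>

lemma max_entry_ge: "diag_vec D $ i \<le> max_entry D"
  by (simp add: max_entry_def)

theorem theorem2: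
  fixes \<mu> :: "(real^'n^'n) measure"
    and \<mu>' :: "(real^'m^'m) measure"
    and \<nu> :: "(real^'n^'n) measure"
    and \<delta> :: real
  assumes "CARD('n) \<ge> 2" and "CARD('m) = CARD('n) - 1"
    and "haar_prob_O \<mu>" and "haar_prob_O \<mu>'"
    and "prob_space \<nu>" and "sets \<nu> = sets (restrict_space borel Delta_pp)"
    and "measure \<nu> Delta_pp_sub = 1"
    and "\<delta> > 0"
  shows "frakF \<delta> \<in> sets (\<mu> \<Otimes>\<^sub>M \<nu>) \<and>
         integrable \<nu> (\<lambda>D. hit_prob \<mu> (ellipsoid (sqrt \<delta> *\<^sub>R diag_vec D))) \<and>
         measure (\<mu> \<Otimes>\<^sub>M \<nu>) (frakF \<delta>) =
           (\<integral>D. hit_prob \<mu> (ellipsoid (sqrt \<delta> *\<^sub>R diag_vec D)) \<partial>\<nu>) \<and>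
         (\<forall>D \<in> Delta_pp.
           integrable sphere_area (hit_prob_slice \<mu>' (ellipsoid (sqrt \<delta> *\<^sub>R diag_vec D))) \<and>
           g_bound \<mu>' D \<delta> \<le> hit_prob \<mu> (ellipsoid (sqrt \<delta> *\<^sub>R diag_vec D)) \<and>
           hit_prob \<mu> (ellipsoid (sqrt \<delta> *\<^sub>R diag_vec D)) \<le> f_bound D \<delta> \<and>
           (sqrt \<delta> * max_entry D < 1 \<longrightarrow> f_sum D \<delta> = 0))"
proof (intro conjI ballI impI)
  show "frakF \<delta> \<in> sets (\<mu> \<Otimes>\<^sub>M \<nu>)"
    by (rule frakF_measurable[OF assms(3,6,8)])
  show "integrable \<nu> (\<lambda>D. hit_prob \<mu> (ellipsoid (sqrt \<delta> *\<^sub>R diag_vec D)))"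
    by (rule integrable_hit_prob_ellipsoid[OF assms(3,6,8,5)])
  show "measure (\<mu> \<Otimes>\<^sub>M \<nu>) (frakF \<delta>) = (\<integral>D. hit_prob \<mu> (ellipsoid (sqrt \<delta> *\<^sub>R diag_vec D)) \<partial>\<nu>)"
    by (rule measure_frakF[OF assms(3,6,8,5)])
next
  fix D :: "real^'n^'n" assume "D \<in> Delta_pp"
  then have pos: "0 < diag_vec D $ i" for i by (simp add: Delta_pp_def diag_vec_def)
  let ?E = "ellipsoid (sqrt \<delta> *\<^sub>R diag_vec D)"
  note slice = assms(4,2) closed_ellipsoid zero_in_ellipsoid
  show "integrable sphere_area (hit_prob_slice \<mu>' ?E)"
    by (rule integrable_hit_prob_slice[OF slice])
  \<comment> \<open>Both entries of the maximum are bounded separately; the division by the total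
    area, inside the integral in \<open>g_bound\<close>, is moved outside.\<close>
  show "g_bound \<mu>' D \<delta> \<le> hit_prob \<mu> ?E"
    using sigma_tilde_le_hit_prob[OF assms(3)] integral_hit_prob_slice_le_hit_prob[OF slice assms(3)]
    by (simp add: g_bound_def)
  show "hit_prob \<mu> ?E \<le> f_bound D \<delta>"
    using hit_prob_le_sum_primitive[OF assms(3) _ pos max_entry_ge, of "sqrt \<delta>"] assms(8)
      hit_prob_le_1[OF assms(3)]
    by (simp add: f_bound_def f_sum_def)
  \<comment> \<open>Primitive vectors are non-zero integer vectors, so they have length at least 1
    and the index set is empty.\<close>
  show "f_sum D \<delta> = 0" if small: "sqrt \<delta> * max_entry D < 1"
  proof -
    have "{n :: int^'n. n \<in> primitive_vectors \<and> norm (of_int_vec n) \<le> sqrt \<delta> * max_entry D} = {}"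
      using small norm_of_int_vec_ge_1[OF primitive_nonzero] by force
    then show ?thesis unfolding f_sum_def by (simp only: sum.empty)
  qed
qed

end
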